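(* Let $X$ be a real Banach space and let $F,E\subset X$ be subspaces such that $X=F\oplus_p E$ isometrically for some $1\le p\le\infty$. If $1\le p\le 2$ and $\dim(F)<\infty$, then $X$ has DES in every direction $(f,0)\in S_{F^*\oplus_{p^*}E^*}$. On the other hand, if $2<p\le\infty$ and $E=\ell^2$, then $X$ does not have DES in any direction $(f,0)\in S_{F^*\oplus_{p^*}\ell^2}$.
   Context: All Banach spaces are real. $B_X$ and $S_X$ denote the closed unit ball and the unit sphere of $X$; $X^*$ is the dual space. $F\oplus_p E$ is the direct sum with norm $\|(x,y)\|=(\|x\|^p+\|y\|^p)^{1/p}$ (and $\max(\|x\|,\|y\|)$ for $p=\infty$); $p^*$ is the conjugate exponent, $\frac1p+\frac1{p^*}=1$, and $X^*$ is identified with $F^*\oplus_{p^*}E^*$, so that $(f,0)$ is the functional $(x,y)\mapsto f(x)$. In the second part $(\ell^2)^*$ is identified with $\ell^2$. An ellipsoid in a finite-dimensional space $G$ is a set $\{x\in G: (x|x)\le 1\}$, where $(\cdot|\cdot)$ is an inner product on $G$. For a finite-dimensional subspace $G\subset X$, $\mathcal{E}_G\subset G$ denotes the unique minimum volume (Lebesgue measure on $G$) ellipsoid containing $B_X\cap G$. For $g\in S_{X^*}$ put $\eta(g,G)=\max\{|g(y)|: y\in\mathcal{E}_G\}$. $X$ has Directionally Euclidean Structure (DES) in direction $g\in S_{X^*}$ if $\inf_H\sup_G\eta(g,G)<\infty$, where the infimum is over finite-dimensional subspaces $H\subset X$ and the supremum is over finite-dimensional subspaces $G\subset X$ with $H\subset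 G$. *)

theory Defs
  imports "HOL-Analysis.Analysis"
begin

section \<open>Subspaces of a real Banach space\<close>

definition finite_dim :: "'a::real_vector set \<Rightarrow> bool" where
  "finite_dim V \<longleftrightarrow> (\<exists>B. finite B \<and> span B = V)"

definition linear_functional_on :: "'a::real_vector set \<Rightarrow> ('a \<Rightarrow> real) \<Rightarrow> bool" where
  "linear_functional_on V f \<longleftrightarrow>
     (\<forall>x\<in>V. \<forall>y\<in>V. f (x + y) = f x + f y) \<and> (\<forall>c. \<forall>x\<in>V. f (c *\<^sub>R x) = c * f x)"

text \<open>Membership in the dual of the subspace \<open>V\<close>. Functionals on \<open>V\<close> are represented by functions
  on the whole type, of which only the values on \<open>V\<close> matter.\<close>

definition dual_of :: "'a::real_normed_vector set \<Rightarrow> ('a \<Rightarrow> real) set" where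
  "dual_of V = {f. linear_functional_on V f \<and> (\<exists>C. \<forall>x\<in>V. \<bar>f x\<bar> \<le> C * norm x)}"

text \<open>The whole space is the internal direct sum of \<open>F\<close> and \<open>E\<close>, with the \<open>p\<close>-sum norm.\<close>

definition is_p_sum :: "ereal \<Rightarrow> 'a::real_normed_vector set \<Rightarrow> 'a set \<Rightarrow> bool" where
  "is_p_sum p F E \<longleftrightarrow>
     subspace F \<and> subspace E \<and> F \<inter> E = {0} \<and> (\<forall>z. \<exists>x\<in>F. \<exists>y\<in>E. z = x + y) \<and>
     (\<forall>x\<in>F. \<forall>y\<in>E. norm (x + y) =
        (if p = \<infinity> then max (norm x) (norm y)
         else (norm x powr real_of_ereal p + norm y powr real_of_ereal p)
                powr (1 / real_of_ereal p)))"

definition component :: "'a::real_vector set \<Rightarrow> 'a set \<Rightarrow> 'a \<Rightarrow> 'a" where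
  "component V W z = (THE x. x \<in> V \<and> (\<exists>y\<in>W. z = x + y))"

text \<open>The functional on the direct sum of \<open>F\<close> and \<open>E\<close> which the pair \<open>(f, h)\<close> is identified with.
  For \<open>f\<close> in the dual of \<open>F\<close>, \<open>h\<close> in the dual of \<open>E\<close> and a \<open>p\<close>-sum of \<open>F\<close> and \<open>E\<close>, the argument of
  \<open>Blinfun\<close> is bounded and linear.\<close>

definition pair_functional ::
  "'a::real_normed_vector set \<Rightarrow> 'a set \<Rightarrow> ('a \<Rightarrow> real) \<Rightarrow> ('a \<Rightarrow> real) \<Rightarrow> 'a \<Rightarrow>\<^sub>L real" where
  "pair_functional F E f h = Blinfun (\<lambda>z. f (component F E z) + h (component E F z))"

definition ell2 :: "(nat \<Rightarrow> real) set" where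
  "ell2 = {a. summable (\<lambda>n. (a n)\<^sup>2)}"

definition ell2_norm :: "(nat \<Rightarrow> real) \<Rightarrow> real" where
  "ell2_norm a = sqrt (\<Sum>n. (a n)\<^sup>2)"

definition isometric_to_ell2 :: "'a::real_normed_vector set \<Rightarrow> bool" where
  "isometric_to_ell2 E \<longleftrightarrow>
     (\<exists>T :: 'a \<Rightarrow> nat \<Rightarrow> real. (\<forall>n. linear_functional_on E (\<lambda>x. T x n)) \<and> T ` E = ell2 \<and>
        (\<forall>x\<in>E. ell2_norm (T x) = norm x))"

section \<open>Minimum volume ellipsoids\<close>

definition inner_product_on :: "'a::real_vector set \<Rightarrow> ('a \<Rightarrow> 'a \<Rightarrow> real) \<Rightarrow> bool" where
  "inner_product_on G q \<longleftrightarrow>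
     (\<forall>y\<in>G. linear_functional_on G (\<lambda>x. q x y)) \<and> (\<forall>x\<in>G. \<forall>y\<in>G. q x y = q y x) \<and>
     (\<forall>x\<in>G. x \<noteq> 0 \<longrightarrow> q x x > 0)"

definition ellipsoid_in :: "'a::real_vector set \<Rightarrow> 'a set \<Rightarrow> bool" where
  "ellipsoid_in G S \<longleftrightarrow> (\<exists>q. inner_product_on G q \<and> S = {x\<in>G. q x x \<le> 1})"

text \<open>Lebesgue measure on a finite-dimensional subspace \<open>G\<close>, transported from coordinates with respect
  to some basis of \<open>G\<close>. Another basis changes it by a positive factor, which does not affect
  comparisons of volumes within \<open>G\<close>.\<close>

definition basis_of :: "'a::real_vector set \<Rightarrow> 'a set" where
  "basis_of G = (SOME B. independent B \<and> span B = G)"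

definition volume_in :: "'a::real_vector set \<Rightarrow> 'a set \<Rightarrow> ennreal" where
  "volume_in G S =
     (let B = basis_of G; M = (\<Pi>\<^sub>M b\<in>B. (lborel :: real measure))
      in emeasure M {c \<in> space M. (\<Sum>b\<in>B. c b *\<^sub>R b) \<in> S})"

definition min_ellipsoid :: "'a::real_normed_vector set \<Rightarrow> 'a set" where
  "min_ellipsoid G =
     (THE S. ellipsoid_in G S \<and> cball 0 1 \<inter> G \<subseteq> S \<and>
        (\<forall>S'. ellipsoid_in G S' \<and> cball 0 1 \<inter> G \<subseteq> S' \<longrightarrow> volume_in G S \<le> volume_in G S'))"

section \<open>Directionally Euclidean structure\<close>

text \<open>The supremum is a maximum because ellipsoids are compact.\<close>

definition eta :: "('a::real_normed_vector \<Rightarrow>\<^sub>L real) \<Rightarrow> 'a set \<Rightarrow> real" where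
  "eta g G = (SUP y\<in>min_ellipsoid G. \<bar>blinfun_apply g y\<bar>)"

text \<open>Meant for \<open>norm g = 1\<close>.\<close>

definition DES :: "('a::real_normed_vector \<Rightarrow>\<^sub>L real) \<Rightarrow> bool" where
  "DES g \<longleftrightarrow>
     (INF H\<in>{H. subspace H \<and> finite_dim H}.
        SUP G\<in>{G. subspace G \<and> finite_dim G \<and> H \<subseteq> G}. ereal (eta g G)) < \<infinity>"

end

theory Submission
  imports Defs
begin

text \<open>
  An ellipsoid in a finite-dimensional space \<open>G\<close> is the unit ball of an inner product \<open>q\<close>, it contains the
  unit ball of \<open>G\<close> iff \<open>q x x \<le> (norm x)\<^sup>2\<close>, and its volume is a constant depending on the dimension times the
  Gaussian integral of \<open>exp (- q x x)\<close> (\<open>gauss_eq_volume\<close>). So the minimum volume ellipsoid belongs to the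
  dominated form that minimises this integral, here called extremal (\<open>min_ellipsoid_eq\<close>). The integral
  is strictly convex in \<open>q\<close>, which gives uniqueness without determinants (\<open>extremal_unique\<close>), and
  existence follows from compactness and Fatou's lemma (\<open>extremal_exists\<close>).

  Let \<open>G\<close> be the sum of a subspace of \<open>F\<close> and a subspace of \<open>E\<close>. The reflection \<open>x + y \<mapsto> x - y\<close> is an
  isometry for every \<open>p\<close>, so that by uniqueness the extremal form splits as \<open>q (x + y) = q x + q y\<close>
  (\<open>extremal_orthogonal\<close>), and its Gaussian integral is the product of those of the two parts.

  For \<open>p \<le> 2\<close> the norm satisfies \<open>(norm x)\<^sup>2 + (norm y)\<^sup>2 \<le> (norm (x + y))\<^sup>2\<close>. Hence a sum of dominated
  forms on the summands is dominated, and if \<open>G\<close> contains \<open>F\<close>, the part of the extremal form on \<open>F\<close> is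
  the extremal form of \<open>F\<close> (\<open>extremal_restrict\<close>). Therefore \<open>eta\<close> has the same value for all \<open>G\<close>
  containing \<open>F\<close> (\<open>eta_p_sum_eq\<close>).

  For \<open>p > 2\<close> let \<open>v \<in> F\<close> with \<open>f v \<noteq> 0\<close>, and suppose \<open>q v v \<ge> \<epsilon>\<close> for extremal forms \<open>q\<close> of spaces \<open>G\<close>
  with a fixed part in \<open>F\<close> and a part of dimension \<open>n\<close> in \<open>E\<close>. For unit vectors \<open>y\<close> of \<open>E\<close> and a suitable
  small \<open>s\<close>, the squared norm of \<open>s v + y\<close> exceeds \<open>1\<close> by less than the amount \<open>\<epsilon> s\<^sup>2\<close> that \<open>q\<close> spends on
  \<open>s v\<close>, which forces \<open>q y y \<le> \<gamma> (norm y)\<^sup>2\<close> on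
  \<open>E\<close> with \<open>\<gamma> < 1\<close> independent of \<open>n\<close>. As \<open>E\<close> is a Hilbert space, \<open>\<mu> (norm y)\<^sup>2\<close> with \<open>\<gamma> < \<mu> < 1\<close> is also a
  form, and together with \<open>(1 - \<mu>) q\<close> on \<open>F\<close> it is dominated. Comparing Gaussian integrals bounds
  \<open>(\<mu> / \<gamma>)\<^sup>n\<close> by a constant, which fails for large \<open>n\<close> (\<open>extremal_small_at\<close>). So \<open>q v v\<close> tends to \<open>0\<close>,
  and \<open>eta \<ge> \<bar>f v\<bar> / sqrt (q v v)\<close> is unbounded.
\<close>

section \<open>Symmetric bilinear forms on a subspace\<close>

definition sym_bilinear_on :: "'a::real_vector set \<Rightarrow> ('a \<Rightarrow> 'a \<Rightarrow> real) \<Rightarrow> bool" where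
  "sym_bilinear_on G q \<longleftrightarrow>
     (\<forall>y\<in>G. linear_functional_on G (\<lambda>x. q x y)) \<and> (\<forall>x\<in>G. \<forall>y\<in>G. q x y = q y x)"

lemma inner_product_onD:
  assumes "inner_product_on G q"
  shows "sym_bilinear_on G q" "\<And>x. x \<in> G \<Longrightarrow> x \<noteq> 0 \<Longrightarrow> q x x > 0"
  using assms by (auto simp: inner_product_on_def sym_bilinear_on_def)

lemma inner_product_onI:
  assumes "sym_bilinear_on G q" "\<And>x. x \<in> G \<Longrightarrow> x \<noteq> 0 \<Longrightarrow> q x x > 0"
  shows "inner_product_on G q"
  using assms by (auto simp: inner_product_on_def sym_bilinear_on_def)

lemma sym_bilinear_onI:
  assumes "\<And>x y z. x \<in> G \<Longrightarrow> y \<in> G \<Longrightarrow> z \<in> G \<Longrightarrow> q (x + y) z = q x z + q y z"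
    and "\<And>a x z. x \<in> G \<Longrightarrow> z \<in> G \<Longrightarrow> q (a *\<^sub>R x) z = a * q x z"
    and "\<And>x y. x \<in> G \<Longrightarrow> y \<in> G \<Longrightarrow> q x y = q y x"
  shows "sym_bilinear_on G q"
  using assms by (simp add: sym_bilinear_on_def linear_functional_on_def)

lemma sym_bilinear_on_mono: "sym_bilinear_on G q \<Longrightarrow> H \<subseteq> G \<Longrightarrow> sym_bilinear_on H q"
  by (simp add: sym_bilinear_on_def linear_functional_on_def subset_iff)

lemma inner_product_on_mono: "inner_product_on G q \<Longrightarrow> H \<subseteq> G \<Longrightarrow> inner_product_on H q"
  by (simp add: inner_product_on_def linear_functional_on_def subset_iff)

lemma linear_functional_on_sum:
  assumes "subspace G" "linear_functional_on G h" "finite I" "\<And>i. i \<in> I \<Longrightarrow> x i \<in> G"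
  shows "h (\<Sum>i\<in>I. a i *\<^sub>R x i) = (\<Sum>i\<in>I. a i * h (x i))"
  using assms(3,4)
proof (induction I rule: finite_induct)
  case empty
  have "h (0 *\<^sub>R 0) = 0 * h 0"
    using assms(1,2) subspace_0 unfolding linear_functional_on_def by blast
  then show ?case by simp
next
  case (insert i I)
  have "a i *\<^sub>R x i \<in> G" "(\<Sum>i\<in>I. a i *\<^sub>R x i) \<in> G"
    using insert.prems assms(1) by (auto intro!: subspace_scale subspace_sum)
  then show ?case
    using insert assms(2) by (simp add: linear_functional_on_def)
qed

context
  fixes G :: "'a::real_vector set" and q :: "'a \<Rightarrow> 'a \<Rightarrow> real"
  assumes G: "subspace G" and q: "sym_bilinear_on G q"
begin

lemma form_add: "x \<in> G \<Longrightarrow> y \<in> G \<Longrightarrow> z \<in> G \<Longrightarrow> q (x + y) z = q x z + q y z"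
  and form_scale: "x \<in> G \<Longrightarrow> z \<in> G \<Longrightarrow> q (a *\<^sub>R x) z = a * q x z"
  and form_sym: "x \<in> G \<Longrightarrow> y \<in> G \<Longrightarrow> q x y = q y x"
  using q by (auto simp: sym_bilinear_on_def linear_functional_on_def)

lemma form_add2: "x \<in> G \<Longrightarrow> y \<in> G \<Longrightarrow> z \<in> G \<Longrightarrow> q z (x + y) = q z x + q z y"
  using form_add form_sym G by (metis subspace_add)

lemma form_scale2: "x \<in> G \<Longrightarrow> z \<in> G \<Longrightarrow> q z (a *\<^sub>R x) = a * q z x"
  using form_scale form_sym G by (metis subspace_scale)

lemma form_zero: "z \<in> G \<Longrightarrow> q 0 z = 0" "z \<in> G \<Longrightarrow> q z 0 = 0"
  using form_scale[of 0 z 0] form_scale2[of 0 z 0] G by (auto simp: subspace_0)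

lemma form_square_scale: "x \<in> G \<Longrightarrow> q (a *\<^sub>R x) (a *\<^sub>R x) = a\<^sup>2 * q x x"
  using G by (simp add: form_scale form_scale2 subspace_scale power2_eq_square)

lemma form_square_minus: "x \<in> G \<Longrightarrow> q (- x) (- x) = q x x"
  using form_square_scale[of x "-1"] by simp

lemma form_square_add:
  "x \<in> G \<Longrightarrow> y \<in> G \<Longrightarrow> q (x + y) (x + y) = q x x + 2 * q x y + q y y"
  using G by (simp add: form_add form_add2 subspace_add form_sym[of y x])

lemma form_square_diff:
  "x \<in> G \<Longrightarrow> y \<in> G \<Longrightarrow> q (x - y) (x - y) = q x x - 2 * q x y + q y y"
  using form_square_add[of x "- y"] form_scale2[of y x "-1"] form_square_minus[of y] G
  by (simp add: subspace_neg)

lemma form_lin_comb: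
  assumes "finite B" "finite B'" "B \<subseteq> G" "B' \<subseteq> G"
  shows "q (\<Sum>b\<in>B. c b *\<^sub>R b) (\<Sum>b\<in>B'. d b *\<^sub>R b) = (\<Sum>b\<in>B. \<Sum>b'\<in>B'. c b * d b' * q b b')"
proof -
  let ?y = "\<Sum>b\<in>B'. d b *\<^sub>R b"
  have y: "?y \<in> G"
    using assms G by (auto intro!: subspace_sum subspace_scale)
  have "q (\<Sum>b\<in>B. c b *\<^sub>R b) ?y = (\<Sum>b\<in>B. c b * q b ?y)"
    using linear_functional_on_sum[OF G, of "\<lambda>x. q x ?y" B "\<lambda>b. b" c] q y assms
    by (auto simp: sym_bilinear_on_def)
  also have "\<dots> = (\<Sum>b\<in>B. \<Sum>b'\<in>B'. c b * d b' * q b b')"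
  proof (rule sum.cong[OF refl])
    fix b assume b: "b \<in> B"
    have "q b ?y = q ?y b" using form_sym b y assms by blast
    also have "\<dots> = (\<Sum>b'\<in>B'. d b' * q b' b)"
      using linear_functional_on_sum[OF G, of "\<lambda>x. q x b" B' "\<lambda>b. b" d] q b assms
      by (auto simp: sym_bilinear_on_def)
    also have "\<dots> = (\<Sum>b'\<in>B'. d b' * q b b')"
      using form_sym b assms by (intro sum.cong) auto
    finally show "c b * q b ?y = (\<Sum>b'\<in>B'. c b * d b' * q b b')"
      by (simp add: sum_distrib_left mult.assoc)
  qed
  finally show ?thesis .
qed

lemma form_Cauchy_Schwarz:
  assumes psd: "\<And>x. x \<in> G \<Longrightarrow> q x x \<ge> 0" and xy: "x \<in> G" "y \<in> G"
  shows "(q x y)\<^sup>2 \<le> q x x * q y y"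
proof -
  have quad: "0 \<le> q x x + 2 * t * q x y + t\<^sup>2 * q y y" for t
    using psd[of "x + t *\<^sub>R y"] form_square_add[of x "t *\<^sub>R y"] form_square_scale[of y t]
      form_scale2[of y x t] xy G by (simp add: subspace_add subspace_scale)
  show ?thesis
  proof (cases "q y y = 0")
    case True
    have "q x y = 0"
    proof (rule ccontr)
      assume n: "q x y \<noteq> 0"
      have "2 * (- (q x x + 1) / (2 * q x y)) * q x y = - (q x x + 1)"
        using n by (simp add: field_simps)
      then show False
        using quad[of "- (q x x + 1) / (2 * q x y)"] True by simp
    qed
    then show ?thesis using True by simp
  next
    case False
    then have pos: "q y y > 0" using psd[OF xy(2)] by simp
    have "2 * (- q x y / q y y) * q x y + (- q x y / q y y)\<^sup>2 * q y y = - (q x y)\<^sup>2 / q y y"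
      using pos by (simp add: field_simps power2_eq_square)
    then have "0 \<le> q x x - (q x y)\<^sup>2 / q y y"
      using quad[of "- q x y / q y y"] by (simp add: add.assoc)
    then show ?thesis using pos by (simp add: field_simps)
  qed
qed

end

lemma inner_product_nonneg:
  assumes "subspace G" "inner_product_on G q" "x \<in> G" shows "q x x \<ge> 0"
proof (cases "x = 0")
  case True
  then show ?thesis using form_zero[OF assms(1) inner_product_onD(1)[OF assms(2)] assms(3)] by simp
next
  case False
  then show ?thesis using inner_product_onD(2)[OF assms(2,3)] by simp
qed

text \<open>The representing vector is built along a spanning set: at each new vector the part orthogonal to
  the old span, which exists by representing the functional given by that vector on the old span,
  supplies the missing coordinate.\<close>

lemma Riesz_representation_span:
  assumes "finite B" "inner_product_on (span B) q" "linear_functional_on (span B) h"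
  shows "\<exists>u\<in>span B. \<forall>x\<in>span B. h x = q x u"
  using assms
proof (induction B arbitrary: h rule: finite_induct)
  case empty
  have "h 0 = 0"
    using linear_functional_on_sum[OF subspace_span empty(2), of "{}"] by simp
  moreover have "q 0 0 = 0"
    using form_zero[OF subspace_span inner_product_onD(1)[OF empty(1)]] by simp
  ultimately show ?case by simp
next
  case (insert v B)
  let ?S = "span (insert v B)"
  note q = inner_product_onD(1)[OF insert.prems(1)]
  have sub: "span B \<subseteq> ?S" by (rule span_mono) auto
  have qB: "inner_product_on (span B) q"
    using insert.prems(1) sub by (rule inner_product_on_mono)
  have v: "v \<in> ?S" by (simp add: span_base)
  have "linear_functional_on (span B) (\<lambda>x. q x v)"
    using q v sub by (simp add: sym_bilinear_on_def linear_functional_on_def subset_iff)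
  then obtain u where u: "u \<in> span B" "\<And>x. x \<in> span B \<Longrightarrow> q x v = q x u"
    using insert.IH[OF qB] by blast
  have "linear_functional_on (span B) h"
    using insert.prems(2) sub by (simp add: linear_functional_on_def subset_iff)
  then obtain u' where u': "u' \<in> span B" "\<And>x. x \<in> span B \<Longrightarrow> h x = q x u'"
    using insert.IH[OF qB] by blast
  define w where "w = v - u"
  have w: "w \<in> ?S" unfolding w_def using v u(1) sub by (blast intro: span_diff)
  have orth: "q x w = 0" if "x \<in> span B" for x
  proof -
    have "q x (v + (-1) *\<^sub>R u) = q x v + (-1) * q x u"
      using form_add2[OF subspace_span q] form_scale2[OF subspace_span q] that sub v u(1)
      by (metis span_scale subsetD)
    then show ?thesis using u(2)[OF that] by (simp add: w_def)
  qed
  have span_w: "x \<in> ?S \<Longrightarrow> \<exists>y\<in>span B. \<exists>t. x = y + t *\<^sub>R w" for x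
  proof -
    assume "x \<in> ?S"
    then obtain k where k: "x - k *\<^sub>R v \<in> span B" by (auto simp: span_insert)
    have "x = (x - k *\<^sub>R v + k *\<^sub>R u) + k *\<^sub>R w" by (simp add: w_def algebra_simps)
    moreover have "x - k *\<^sub>R v + k *\<^sub>R u \<in> span B" using k u(1) by (intro span_add span_scale)
    ultimately show ?thesis by blast
  qed
  define s where "s = h w / q w w"
  define u'' where "u'' = u' + s *\<^sub>R w"
  have u'': "u'' \<in> ?S" unfolding u''_def using w u'(1) sub by (blast intro: span_add span_scale)
  have sw: "s * q w w = h w"
  proof (cases "w = 0")
    case True
    have "h 0 = 0" using linear_functional_on_sum[OF subspace_span insert.prems(2), of "{}"] by simp
    then show ?thesis by (simp add: s_def True)
  next
    case False
    then show ?thesis using inner_product_onD(2)[OF insert.prems(1) w] by (simp add: s_def)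
  qed
  have "h x = q x u''" if xS: "x \<in> ?S" for x
  proof -
    obtain y t where y: "y \<in> span B" and x: "x = y + t *\<^sub>R w" using span_w[OF xS] by blast
    have yS: "y \<in> ?S" and u'S: "u' \<in> ?S" using y u'(1) sub by auto
    have 1: "q y u'' = h y"
      unfolding u''_def using form_add2[OF subspace_span q u'S _ yS, of "s *\<^sub>R w"]
        form_scale2[OF subspace_span q w yS, of s] orth[OF y] u'(2)[OF y] w by (simp add: span_scale)
    have "q w u' = 0" using orth[OF u'(1)] form_sym[OF subspace_span q w u'S] by simp
    then have 2: "q w u'' = h w"
      unfolding u''_def using form_add2[OF subspace_span q u'S _ w, of "s *\<^sub>R w"]
        form_scale2[OF subspace_span q w w, of s] sw w by (simp add: span_scale)
    have "q x u'' = q y u'' + t * q w u''"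
      unfolding x using form_add[OF subspace_span q yS _ u'', of "t *\<^sub>R w"]
        form_scale[OF subspace_span q w u'', of t] w by (simp add: span_scale)
    also have "\<dots> = h y + t * h w" using 1 2 by simp
    also have "\<dots> = h x"
      unfolding x using insert.prems(2) yS w by (simp add: linear_functional_on_def span_scale)
    finally show ?thesis by simp
  qed
  then show ?case using u'' by blast
qed

text \<open>Applied to coordinate functionals this bounds ellipsoids, and applied to a direction it shows
  that its supremum over an ellipsoid is finite.\<close>

lemma linear_functional_on_bounded_by_form:
  assumes "finite B" "inner_product_on (span B) q" "linear_functional_on (span B) h"
  obtains C where "C > 0" "\<And>x. x \<in> span B \<Longrightarrow> (h x)\<^sup>2 \<le> C * q x x"
proof -
  obtain u where u: "u \<in> span B" "\<And>x. x \<in> span B \<Longrightarrow> h x = q x u"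
    using Riesz_representation_span[OF assms] by blast
  have nn: "x \<in> span B \<Longrightarrow> q x x \<ge> 0" for x using inner_product_nonneg[OF subspace_span assms(2)] .
  have "(h x)\<^sup>2 \<le> (q u u + 1) * q x x" if "x \<in> span B" for x
    using form_Cauchy_Schwarz[OF subspace_span inner_product_onD(1)[OF assms(2)] nn that u(1)]
      u(2)[OF that] nn[OF that] by (simp add: algebra_simps)
  moreover have "q u u + 1 > 0" using nn[OF u(1)] by simp
  ultimately show ?thesis using that by blast
qed

section \<open>Lebesgue measure in coordinates\<close>

abbreviation lborel_on :: "'a set \<Rightarrow> ('a \<Rightarrow> real) measure" where
  "lborel_on B \<equiv> \<Pi>\<^sub>M b\<in>B. lborel"

abbreviation lincomb :: "'a::real_vector set \<Rightarrow> ('a \<Rightarrow> real) \<Rightarrow> 'a" where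
  "lincomb B c \<equiv> \<Sum>b\<in>B. c b *\<^sub>R b"

lemma product_sigma_finite_lborel: "product_sigma_finite (\<lambda>_. lborel :: real measure)"
  by unfold_locales

lemma sigma_finite_lborel_on: "finite B \<Longrightarrow> sigma_finite_measure (lborel_on B)"
  by (rule product_sigma_finite.sigma_finite[OF product_sigma_finite_lborel])

lemma lborel_on_affine:
  assumes B: "finite B" and r: "\<And>b. b \<in> B \<Longrightarrow> r b \<noteq> 0"
  shows "lborel_on B = density (distr (lborel_on B) (lborel_on B) (\<lambda>c. \<lambda>b\<in>B. a b + r b * c b))
    (\<lambda>_. \<Prod>b\<in>B. ennreal \<bar>r b\<bar>)" (is "_ = ?D")
proof (rule sym, rule product_sigma_finite.PiM_eqI[OF product_sigma_finite_lborel B])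
  show "sets ?D = sets (lborel_on B)" by simp
next
  fix A :: "'a \<Rightarrow> real set" assume A: "\<And>b. b \<in> B \<Longrightarrow> A b \<in> sets lborel"
  let ?f = "\<lambda>c. \<lambda>b\<in>B. a b + r b * c b"
  have [measurable]: "?f \<in> measurable (lborel_on B) (lborel_on B)" by measurable
  have PA: "Pi\<^sub>E B A \<in> sets (lborel_on B)" using A B by (intro sets_PiM_I_finite) auto
  have pre: "?f -` Pi\<^sub>E B A \<inter> space (lborel_on B) = Pi\<^sub>E B (\<lambda>b. (\<lambda>t. a b + r b * t) -` A b)"
    by (auto simp: space_PiM PiE_iff)
  have Ab: "(\<lambda>t. a b + r b * t) -` A b \<in> sets lborel" if "b \<in> B" for b
    using A[OF that] measurable_sets_borel[of "\<lambda>t. a b + r b * t" "lborel" "A b"] by simp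
  have "emeasure ?D (Pi\<^sub>E B A)
      = (\<Prod>b\<in>B. ennreal \<bar>r b\<bar>) * emeasure (lborel_on B) (Pi\<^sub>E B (\<lambda>b. (\<lambda>t. a b + r b * t) -` A b))"
    using PA by (simp add: emeasure_density nn_integral_cmult_indicator emeasure_distr pre)
  also have "\<dots> = (\<Prod>b\<in>B. ennreal \<bar>r b\<bar>) * (\<Prod>b\<in>B. emeasure lborel ((\<lambda>t. a b + r b * t) -` A b))"
    using product_sigma_finite.emeasure_PiM[OF product_sigma_finite_lborel B,
        of "\<lambda>b. (\<lambda>t. a b + r b * t) -` A b"] Ab by simp
  also have "\<dots> = (\<Prod>b\<in>B. ennreal \<bar>r b\<bar> * emeasure lborel ((\<lambda>t. a b + r b * t) -` A b))"
    by (simp add: prod.distrib)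
  also have "\<dots> = (\<Prod>b\<in>B. emeasure lborel (A b))"
  proof (rule prod.cong[OF refl])
    fix b assume b: "b \<in> B"
    have "emeasure lborel (A b)
        = emeasure (density (distr lborel borel (\<lambda>x. a b + r b * x)) (\<lambda>_. ennreal \<bar>r b\<bar>)) (A b)"
      by (subst lborel_real_affine[OF r[OF b], of "a b"]) rule
    also have "\<dots> = ennreal \<bar>r b\<bar> * emeasure lborel ((\<lambda>t. a b + r b * t) -` A b)"
      using A[OF b] by (simp add: emeasure_density nn_integral_cmult_indicator emeasure_distr)
    finally show "ennreal \<bar>r b\<bar> * emeasure lborel ((\<lambda>t. a b + r b * t) -` A b) = emeasure lborel (A b)"
      by simp
  qed
  finally show "emeasure ?D (Pi\<^sub>E B A) = (\<Prod>b\<in>B. emeasure lborel (A b))" .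
qed

lemma nn_integral_lborel_on_affine:
  assumes "finite B" "\<And>b. b \<in> B \<Longrightarrow> r b \<noteq> 0" and [measurable]: "h \<in> borel_measurable (lborel_on B)"
  shows "(\<integral>\<^sup>+c. h c \<partial>lborel_on B)
    = (\<Prod>b\<in>B. ennreal \<bar>r b\<bar>) * (\<integral>\<^sup>+c. h (\<lambda>b\<in>B. a b + r b * c b) \<partial>lborel_on B)"
proof -
  have [measurable]: "(\<lambda>c. \<lambda>b\<in>B. a b + r b * c b) \<in> measurable (lborel_on B) (lborel_on B)"
    by measurable
  show ?thesis
    by (subst lborel_on_affine[OF assms(1,2), where a = a])
      (simp_all add: nn_integral_density nn_integral_cmult nn_integral_distr)
qed

lemma lincomb_in_span: "lincomb B c \<in> span B"
  by (intro span_sum span_scale span_base)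

lemma nn_integral_lincomb_translate:
  assumes "finite B" "x0 \<in> span B" "(\<lambda>c. h (lincomb B c)) \<in> borel_measurable (lborel_on B)"
  shows "(\<integral>\<^sup>+c. h (lincomb B c + x0) \<partial>lborel_on B) = (\<integral>\<^sup>+c. h (lincomb B c) \<partial>lborel_on B)"
proof -
  obtain a where a: "x0 = lincomb B a" using assms(1,2) by (auto simp: span_finite)
  have *: "lincomb B (\<lambda>b\<in>B. a b + 1 * c b) = lincomb B c + x0" for c
    by (simp add: a scaleR_add_left sum.distrib add.commute cong: sum.cong)
  have "(\<integral>\<^sup>+c. h (lincomb B c) \<partial>lborel_on B)
      = (\<integral>\<^sup>+c. h (lincomb B (\<lambda>b\<in>B. a b + 1 * c b)) \<partial>lborel_on B)"
    using nn_integral_lborel_on_affine[OF assms(1) _ assms(3), of "\<lambda>_. 1" a] by simp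
  then show ?thesis unfolding * by simp
qed

lemma measurable_form:
  assumes "finite B" "finite B'" "sym_bilinear_on (span (B \<union> B')) q"
    and [measurable]: "f \<in> measurable N (lborel_on B)" "g \<in> measurable N (lborel_on B')"
  shows "(\<lambda>c. q (lincomb B (f c)) (lincomb B' (g c))) \<in> borel_measurable N"
proof -
  have *: "q (lincomb B c) (lincomb B' d) = (\<Sum>b\<in>B. \<Sum>b'\<in>B'. c b * d b' * q b b')" for c d
    using assms(1-3) span_superset[of "B \<union> B'"] by (intro form_lin_comb[OF subspace_span]) auto
  show ?thesis
    unfolding * by (intro borel_measurable_sum borel_measurable_times borel_measurable_const)
      (use measurable_compose[OF assms(4) measurable_component_singleton]
        measurable_compose[OF assms(5) measurable_component_singleton] in auto)
qed

section \<open>The Gaussian integral of a form\<close>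

text \<open>Up to a factor depending on the dimension only, this is the volume of the ellipsoid of \<open>q\<close> in the
  coordinates of \<open>B\<close>. Unlike the volume it is visibly convex in \<open>q\<close> and multiplicative on orthogonal
  sums.\<close>

definition gauss :: "'a::real_vector set \<Rightarrow> ('a \<Rightarrow> 'a \<Rightarrow> real) \<Rightarrow> ennreal" where
  "gauss B q = (\<integral>\<^sup>+c. ennreal (exp (- q (lincomb B c) (lincomb B c))) \<partial>lborel_on B)"

lemma measurable_form_square:
  assumes "finite B" "sym_bilinear_on (span B) q"
  shows "(\<lambda>c. q (lincomb B c) (lincomb B c)) \<in> borel_measurable (lborel_on B)"
  using assms by (intro measurable_form) auto

lemma measurable_form_square_add:
  assumes B: "finite B" and B': "finite B'" "span B' = span B" and q: "sym_bilinear_on (span B) q"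
    and f: "f \<in> measurable N (lborel_on B)" and g: "g \<in> measurable N (lborel_on B')"
  shows "(\<lambda>z. q (lincomb B (f z) + lincomb B' (g z)) (lincomb B (f z) + lincomb B' (g z)))
    \<in> borel_measurable N"
proof -
  have U: "span (B \<union> B') = span B"
  proof
    have "B \<union> B' \<subseteq> span B"
      using span_superset[of B] span_superset[of B'] B'(2) by auto
    then show "span (B \<union> B') \<subseteq> span B" by (rule span_minimal) (rule subspace_span)
    show "span B \<subseteq> span (B \<union> B')" by (rule span_mono) simp
  qed
  have l: "lincomb B c \<in> span B" "lincomb B' d \<in> span B" for c d
    using lincomb_in_span[of c B] lincomb_in_span[of d B'] B'(2) by simp_all
  have "(\<lambda>z. q (lincomb B (f z)) (lincomb B (f z)) + 2 * q (lincomb B (f z)) (lincomb B' (g z))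
      + q (lincomb B' (g z)) (lincomb B' (g z))) \<in> borel_measurable N"
    using q U B'(2)
    by (intro borel_measurable_add borel_measurable_times borel_measurable_const
        measurable_form[OF B B, where q = q] measurable_form[OF B B'(1), where q = q]
        measurable_form[OF B'(1) B'(1), where q = q] f g) simp_all
  then show ?thesis
    by (subst form_square_add[OF subspace_span q l])
qed

lemma gauss_cong:
  "(\<And>x. x \<in> span B \<Longrightarrow> q x x = q' x x) \<Longrightarrow> gauss B q = gauss B q'"
  unfolding gauss_def by (intro nn_integral_cong) (simp add: lincomb_in_span)

lemma gauss_antimono:
  "(\<And>x. x \<in> span B \<Longrightarrow> q x x \<le> q' x x) \<Longrightarrow> gauss B q' \<le> gauss B q"
  unfolding gauss_def by (intro nn_integral_mono) (simp add: lincomb_in_span ennreal_leI)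

lemma emeasure_lborel_on_UNIV: "finite B \<Longrightarrow> emeasure (lborel_on B) (space (lborel_on B)) \<noteq> 0"
  using product_sigma_finite.emeasure_PiM[OF product_sigma_finite_lborel, of B "\<lambda>_. UNIV"]
  by (simp add: space_PiM)

lemma gauss_pos:
  assumes "finite B" "sym_bilinear_on (span B) q" shows "gauss B q > 0"
proof -
  note [measurable] = measurable_form_square[OF assms]
  have "gauss B q \<noteq> 0"
  proof
    assume "gauss B q = 0"
    then have "AE c in lborel_on B. ennreal (exp (- q (lincomb B c) (lincomb B c))) = 0"
      unfolding gauss_def by (subst (asm) nn_integral_0_iff_AE) auto
    then have "AE c in lborel_on B. False" by eventually_elim (simp add: ennreal_eq_0_iff not_le)
    then show False using emeasure_lborel_on_UNIV[OF assms(1)]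
      by (subst (asm) AE_iff_measurable[OF _ refl]) auto
  qed
  then show ?thesis by (simp add: zero_less_iff_neq_zero)
qed

text \<open>Two bases of the same space give proportional Gaussian integrals. Instead of a determinant, the
  uniqueness argument for Haar measure is used: \<open>exp (- q1 (x + y)) * exp (- q2 y)\<close> is integrated over
  \<open>x\<close> in the coordinates of \<open>B\<close> and \<open>y\<close> in those of \<open>B'\<close>. Translating \<open>x\<close> by \<open>- y\<close>, or \<open>y\<close> by \<open>- x\<close>,
  separates the variables in two different ways.\<close>

lemma gauss_change_basis:
  assumes B: "finite B" "finite B'" "span B' = span B"
    and q1: "sym_bilinear_on (span B) q1" and q2: "sym_bilinear_on (span B) q2"
  shows "gauss B q1 * gauss B' q2 = gauss B' q1 * gauss B q2"
proof -
  define e1 e2 where "e1 x = ennreal (exp (- q1 x x))" and "e2 x = ennreal (exp (- q2 x x))" for x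
  let ?M = "lborel_on B" and ?N = "lborel_on B'"
  have l: "lincomb B c \<in> span B" "lincomb B' d \<in> span B" for c d
    using lincomb_in_span[of c B] lincomb_in_span[of d B'] B(3) by simp_all
  have q1': "sym_bilinear_on (span B') q1" and q2': "sym_bilinear_on (span B') q2"
    using q1 q2 B(3) by simp_all
  note [measurable] = measurable_form_square[OF B(1) q1] measurable_form_square[OF B(1) q2]
    measurable_form_square[OF B(2) q1'] measurable_form_square[OF B(2) q2']
  have t1: "(\<integral>\<^sup>+c. e1 (lincomb B c + y) \<partial>?M) = gauss B q1" if "y \<in> span B" for y
    unfolding gauss_def e1_def using nn_integral_lincomb_translate[OF B(1) that,
        where h = "\<lambda>x. ennreal (exp (- q1 x x))"] by simp
  have t2: "(\<integral>\<^sup>+c. e2 (lincomb B c + y) \<partial>?M) = gauss B q2" if "y \<in> span B" for y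
    unfolding gauss_def e2_def using nn_integral_lincomb_translate[OF B(1) that,
        where h = "\<lambda>x. ennreal (exp (- q2 x x))"] by simp
  interpret pair_sigma_finite ?M ?N
    using sigma_finite_lborel_on B by (intro pair_sigma_finite.intro)
  have F1: "case_prod (\<lambda>c d. e1 (lincomb B c + lincomb B' d) * e2 (lincomb B' d))
      \<in> borel_measurable (?M \<Otimes>\<^sub>M ?N)"
  proof -
    note [measurable] = measurable_form_square_add[OF B q1 measurable_fst measurable_snd]
      measurable_compose[OF measurable_snd measurable_form_square[OF B(2) q2']]
    show ?thesis unfolding e1_def e2_def case_prod_beta by measurable
  qed
  have F2: "case_prod (\<lambda>c d. e1 (lincomb B' d) * e2 (lincomb B c + (- 1) *\<^sub>R lincomb B' d))
      \<in> borel_measurable (?M \<Otimes>\<^sub>M ?N)"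
  proof -
    have *: "(- 1) *\<^sub>R lincomb B' d = lincomb B' (\<lambda>b\<in>B'. 0 + (- 1) * d b)" for d
      by (simp add: sum_negf cong: sum.cong)
    have m: "(\<lambda>d. \<lambda>b\<in>B'. 0 + (- 1) * d b) \<in> measurable ?N ?N" by measurable
    note [measurable] = measurable_compose[OF measurable_snd measurable_form_square[OF B(2) q1']]
      measurable_form_square_add[OF B q2 measurable_fst measurable_compose[OF measurable_snd m]]
    show ?thesis unfolding e1_def e2_def case_prod_beta * by measurable
  qed
  have "gauss B q1 * gauss B' q2 = (\<integral>\<^sup>+d. gauss B q1 * e2 (lincomb B' d) \<partial>?N)"
    unfolding gauss_def[of B' q2] e2_def by (rule nn_integral_cmult[symmetric]) measurable
  also have "\<dots> = (\<integral>\<^sup>+d. \<integral>\<^sup>+c. e1 (lincomb B c + lincomb B' d) * e2 (lincomb B' d) \<partial>?M \<partial>?N)"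
  proof (rule nn_integral_cong)
    fix d
    have "(\<lambda>c. e1 (lincomb B c + lincomb B' d)) \<in> borel_measurable ?M"
    proof -
      obtain a where a: "lincomb B' d = lincomb B (restrict a B)"
        using l(2)[of d] B(1) by (auto simp: span_finite cong: sum.cong)
      have "restrict a B \<in> space ?M" by (simp add: space_PiM)
      then have [measurable]: "(\<lambda>c. q1 (lincomb B c + lincomb B (restrict a B))
          (lincomb B c + lincomb B (restrict a B))) \<in> borel_measurable ?M"
        using measurable_form_square_add[OF B(1) B(1) refl q1 measurable_ident measurable_const,
            of "restrict a B"] by (simp add: id_def)
      show ?thesis unfolding a e1_def by measurable
    qed
    then show "gauss B q1 * e2 (lincomb B' d)
      = (\<integral>\<^sup>+c. e1 (lincomb B c + lincomb B' d) * e2 (lincomb B' d) \<partial>?M)"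
      by (simp add: nn_integral_multc t1[OF l(2)])
  qed
  also have "\<dots> = (\<integral>\<^sup>+c. \<integral>\<^sup>+d. e1 (lincomb B c + lincomb B' d) * e2 (lincomb B' d) \<partial>?N \<partial>?M)"
    by (rule Fubini'[OF F1])
  also have "\<dots> = (\<integral>\<^sup>+c. \<integral>\<^sup>+d. e1 (lincomb B' d) * e2 (lincomb B c + (- 1) *\<^sub>R lincomb B' d) \<partial>?N \<partial>?M)"
  proof (rule nn_integral_cong)
    fix c assume c: "c \<in> space ?M"
    let ?h = "\<lambda>x. e1 x * e2 (lincomb B c + (- 1) *\<^sub>R x)"
    have "(\<lambda>d. ?h (lincomb B' d)) \<in> borel_measurable ?N"
      using measurable_compose[OF measurable_Pair1'[OF c] F2] by simp
    moreover have "lincomb B c \<in> span B'" using l B(3) by simp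
    ultimately have "(\<integral>\<^sup>+d. ?h (lincomb B' d + lincomb B c) \<partial>?N) = (\<integral>\<^sup>+d. ?h (lincomb B' d) \<partial>?N)"
      using nn_integral_lincomb_translate[OF B(2), of "lincomb B c" ?h] by simp
    moreover have "?h (lincomb B' d + lincomb B c) = e1 (lincomb B c + lincomb B' d) * e2 (lincomb B' d)" for d
    proof -
      have "e2 (- lincomb B' d) = e2 (lincomb B' d)"
        unfolding e2_def using form_square_minus[OF subspace_span q2 l(2)] by simp
      then show ?thesis by (simp add: add.commute)
    qed
    ultimately show "(\<integral>\<^sup>+d. e1 (lincomb B c + lincomb B' d) * e2 (lincomb B' d) \<partial>?N)
      = (\<integral>\<^sup>+d. ?h (lincomb B' d) \<partial>?N)" by simp
  qed
  also have "\<dots> = (\<integral>\<^sup>+d. \<integral>\<^sup>+c. e1 (lincomb B' d) * e2 (lincomb B c + (- 1) *\<^sub>R lincomb B' d) \<partial>?M \<partial>?N)"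
    by (rule Fubini'[OF F2, symmetric])
  also have "\<dots> = (\<integral>\<^sup>+d. e1 (lincomb B' d) * gauss B q2 \<partial>?N)"
  proof (rule nn_integral_cong)
    fix d assume d: "d \<in> space ?N"
    have y: "(- 1) *\<^sub>R lincomb B' d \<in> span B" by (intro span_scale l)
    obtain a where a: "(- 1) *\<^sub>R lincomb B' d = lincomb B (restrict a B)"
      using y B(1) by (auto simp: span_finite cong: sum.cong)
    have "restrict a B \<in> space ?M" by (simp add: space_PiM)
    then have [measurable]: "(\<lambda>c. q2 (lincomb B c + lincomb B (restrict a B))
        (lincomb B c + lincomb B (restrict a B))) \<in> borel_measurable ?M"
      using measurable_form_square_add[OF B(1) B(1) refl q2 measurable_ident measurable_const,
          of "restrict a B"] by (simp add: id_def)
    have "(\<lambda>c. e2 (lincomb B c + (- 1) *\<^sub>R lincomb B' d)) \<in> borel_measurable ?M"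
      unfolding a e2_def by measurable
    then show "(\<integral>\<^sup>+c. e1 (lincomb B' d) * e2 (lincomb B c + (- 1) *\<^sub>R lincomb B' d) \<partial>?M)
      = e1 (lincomb B' d) * gauss B q2"
      using t2[OF y] by (simp add: nn_integral_cmult)
  qed
  also have "\<dots> = gauss B' q1 * gauss B q2"
    unfolding gauss_def[of B' q1] e1_def by (rule nn_integral_multc) measurable
  finally show ?thesis .
qed

text \<open>A semidefinite form that vanishes at a nonzero vector \<open>v\<close> is constant along \<open>v\<close>, so that the slabs
  \<open>k < c b0 \<le> k + 1\<close> for a coordinate \<open>b0\<close> of \<open>v\<close> all contribute the same positive amount.\<close>

lemma gauss_degenerate:
  assumes B: "finite B" "independent B" and q: "sym_bilinear_on (span B) q"
    and psd: "\<And>x. x \<in> span B \<Longrightarrow> q x x \<ge> 0"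
    and v: "v \<in> span B" "v \<noteq> 0" "q v v = 0"
  shows "gauss B q = \<infinity>"
proof -
  let ?M = "lborel_on B"
  note [measurable] = measurable_form_square[OF B(1) q]
  obtain a' where a': "v = lincomb B a'" using v(1) B(1) by (auto simp: span_finite)
  obtain b0 where b0: "b0 \<in> B" "a' b0 \<noteq> 0"
    using a' v(2) by (metis (no_types, lifting) scaleR_eq_0_iff sum.neutral)
  \<comment> \<open>\<open>u\<close> is the multiple of \<open>v\<close> that moves each slab exactly onto the next one.\<close>
  define a where "a b = a' b / a' b0" for b
  define u where "u = lincomb B a"
  have a0: "a b0 = 1" using b0 by (simp add: a_def)
  have u_eq: "u = (1 / a' b0) *\<^sub>R v"
    unfolding u_def a' a_def scaleR_sum_right by simp
  have u: "u \<in> span B" "q u u = 0"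
    unfolding u_eq using v form_square_scale[OF subspace_span q v(1)] by (auto intro: span_scale)
  have qu: "q x u = 0" if "x \<in> span B" for x
    using form_Cauchy_Schwarz[OF subspace_span q psd that u(1)] u(2) by simp
  define e where "e c = ennreal (exp (- q (lincomb B c) (lincomb B c)))" for c
  have [measurable]: "e \<in> borel_measurable ?M" unfolding e_def by measurable
  have [measurable]: "(\<lambda>c. c b0) \<in> borel_measurable ?M"
    using measurable_component_singleton[OF b0(1), of "\<lambda>_. lborel :: real measure"] by simp
  define slab where "slab k = (\<integral>\<^sup>+c. e c * indicator {c. of_int k < c b0 \<and> c b0 \<le> of_int k + 1} c \<partial>?M)"
    for k :: int
  have slab0: "slab k = slab 0" for k
  proof -
    have "slab k = (\<integral>\<^sup>+c. e (\<lambda>b\<in>B. of_int k * a b + 1 * c b) * indicator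
        {c. of_int k < c b0 \<and> c b0 \<le> of_int k + 1} (\<lambda>b\<in>B. of_int k * a b + 1 * c b) \<partial>?M)"
      unfolding slab_def
      by (subst nn_integral_lborel_on_affine[OF B(1), of "\<lambda>_. 1" _ "\<lambda>b. of_int k * a b"]) simp_all
    also have "\<dots> = slab 0"
      unfolding slab_def
    proof (intro nn_integral_cong)
      fix c :: "'a \<Rightarrow> real"
      have "lincomb B (\<lambda>b\<in>B. of_int k * a b + 1 * c b) = lincomb B c + of_int k *\<^sub>R u"
        by (simp add: u_def scaleR_add_left sum.distrib scaleR_sum_right add.commute cong: sum.cong)
      moreover have "q (lincomb B c + of_int k *\<^sub>R u) (lincomb B c + of_int k *\<^sub>R u) = q (lincomb B c) (lincomb B c)"
        using form_square_add[OF subspace_span q lincomb_in_span span_scale[OF u(1)]]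
          form_scale2[OF subspace_span q u(1) lincomb_in_span] qu[OF lincomb_in_span]
          form_square_scale[OF subspace_span q u(1)] u(2) by simp
      ultimately have "e (\<lambda>b\<in>B. of_int k * a b + 1 * c b) = e c" by (simp add: e_def)
      then show "e (\<lambda>b\<in>B. of_int k * a b + 1 * c b) * indicator
        {c. of_int k < c b0 \<and> c b0 \<le> of_int k + 1} (\<lambda>b\<in>B. of_int k * a b + 1 * c b)
        = e c * indicator {c. of_int 0 < c b0 \<and> c b0 \<le> of_int 0 + 1} c"
        using b0(1) a0 by (simp add: indicator_def)
    qed
    finally show ?thesis .
  qed
  have le: "of_nat n * slab 0 \<le> gauss B q" for n :: nat
  proof -
    have "(\<Sum>k<n. slab (int k)) = (\<Sum>k<n. slab 0)" by (intro sum.cong refl slab0)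
    then have "of_nat n * slab 0 = (\<Sum>k<n. slab (int k))" by simp
    also have "\<dots> = (\<integral>\<^sup>+c. (\<Sum>k<n. e c * indicator {c. of_int (int k) < c b0 \<and> c b0 \<le> of_int (int k) + 1} c) \<partial>?M)"
      unfolding slab_def by (rule nn_integral_sum[symmetric]) measurable
    also have "\<dots> \<le> (\<integral>\<^sup>+c. e c \<partial>?M)"
    proof (intro nn_integral_mono)
      fix c :: "'a \<Rightarrow> real"
      let ?I = "\<lambda>k::nat. indicator {c. of_int (int k) < c b0 \<and> c b0 \<le> of_int (int k) + 1} c :: ennreal"
      \<comment> \<open>Each point lies in at most one slab.\<close>
      have "?I k = (if k = nat (\<lceil>c b0\<rceil> - 1) then ?I k else 0)" for k
      proof -
        have "k = nat (\<lceil>c b0\<rceil> - 1)" if "of_int (int k) < c b0" "c b0 \<le> of_int (int k) + 1"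
        proof -
          have "\<lceil>c b0\<rceil> = int k + 1" using that by (intro ceiling_unique) auto
          then show ?thesis by simp
        qed
        then show ?thesis by (auto simp: indicator_def)
      qed
      then have "(\<Sum>k<n. ?I k) = (\<Sum>k<n. if k = nat (\<lceil>c b0\<rceil> - 1) then ?I k else 0)"
        by (intro sum.cong) auto
      also have "\<dots> \<le> 1" by (simp add: sum.delta' indicator_def)
      finally have "e c * (\<Sum>k<n. ?I k) \<le> e c * 1" by (rule mult_left_mono) simp
      then show "(\<Sum>k<n. e c * ?I k) \<le> e c" by (simp add: sum_distrib_left)
    qed
    finally show ?thesis by (simp add: gauss_def e_def)
  qed
  have pos: "slab 0 \<noteq> 0"
  proof
    let ?S = "{c \<in> space ?M. 0 < c b0 \<and> c b0 \<le> 1}"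
    assume "slab 0 = 0"
    then have "AE c in ?M. e c * indicator {c. 0 < c b0 \<and> c b0 \<le> 1} c = 0"
      unfolding slab_def by (subst (asm) nn_integral_0_iff_AE) auto
    then have "AE c in ?M. c \<notin> ?S"
      by eventually_elim (auto simp: e_def indicator_def ennreal_eq_0_iff not_le)
    then have "emeasure ?M ?S = 0"
      using AE_iff_measurable[of ?S ?M "\<lambda>c. c \<notin> ?S"] by auto
    moreover have "?S = Pi\<^sub>E B (\<lambda>b. if b = b0 then {0<..1} else UNIV)"
      using b0(1) by (auto simp: space_PiM PiE_iff extensional_def split: if_splits)
    ultimately show False
      using product_sigma_finite.emeasure_PiM[OF product_sigma_finite_lborel B(1),
          of "\<lambda>b. if b = b0 then {0<..1} else UNIV"] B(1)
      by (auto split: if_splits)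
  qed
  show ?thesis
  proof (rule ccontr)
    assume "gauss B q \<noteq> \<infinity>"
    then obtain r where r: "gauss B q = ennreal r" "r \<ge> 0"
      by (cases "gauss B q") auto
    obtain s where s: "slab 0 = ennreal s" "s > 0"
      using le[of 1] pos r by (cases "slab 0") (auto simp: less_le top_unique)
    obtain n where "r < real n * s" using reals_Archimedean3[OF s(2)] by blast
    then have "ennreal r < ennreal (real n * s)" using r(2) by (simp add: ennreal_less_iff)
    then show False using le[of n] r s
      by (simp add: ennreal_of_nat_eq_real_of_nat ennreal_mult'[symmetric] flip: not_less)
  qed
qed

section \<open>Volumes, products and strict convexity\<close>

lemma gauss_scale:
  assumes B: "finite B" and q: "sym_bilinear_on (span B) q" and r: "r > 0"
  shows "gauss B q = ennreal (r ^ card B) * gauss B (\<lambda>x y. r\<^sup>2 * q x y)"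
proof -
  note [measurable] = measurable_form_square[OF B q]
  have "lincomb B (\<lambda>b\<in>B. 0 + r * c b) = r *\<^sub>R lincomb B c" for c
    by (simp add: scaleR_sum_right cong: sum.cong)
  then have *: "q (lincomb B (\<lambda>b\<in>B. 0 + r * c b)) (lincomb B (\<lambda>b\<in>B. 0 + r * c b))
      = r\<^sup>2 * q (lincomb B c) (lincomb B c)" for c
    by (simp add: form_square_scale[OF subspace_span q lincomb_in_span])
  have "gauss B q = (\<Prod>b\<in>B. ennreal \<bar>r\<bar>) * gauss B (\<lambda>x y. r\<^sup>2 * q x y)"
    unfolding gauss_def *[symmetric] using B r
    by (intro nn_integral_lborel_on_affine) auto
  then show ?thesis using r by (simp add: ennreal_power)
qed

lemma gauss_form_scale:
  assumes B: "finite B" and q: "sym_bilinear_on (span B) q" and a: "a > 0"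
  shows "gauss B (\<lambda>x y. a * q x y) = ennreal (1 / sqrt a ^ card B) * gauss B q"
proof -
  have "gauss B q = ennreal (sqrt a ^ card B) * gauss B (\<lambda>x y. a * q x y)"
    using gauss_scale[OF B q, of "sqrt a"] a by simp
  moreover have "ennreal (1 / sqrt a ^ card B) * ennreal (sqrt a ^ card B) = 1"
    using a by (subst ennreal_mult[symmetric]) auto
  ultimately show ?thesis by (simp flip: mult.assoc)
qed

lemma ball_in_coordinates_scale:
  assumes B: "finite B" and q: "sym_bilinear_on (span B) q" and t: "t > 0"
  shows "emeasure (lborel_on B) {c \<in> space (lborel_on B). q (lincomb B c) (lincomb B c) \<le> t}
    = ennreal (sqrt t ^ card B)
      * emeasure (lborel_on B) {c \<in> space (lborel_on B). q (lincomb B c) (lincomb B c) \<le> 1}"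
proof -
  let ?M = "lborel_on B" let ?q = "\<lambda>c. q (lincomb B c) (lincomb B c)"
  note [measurable] = measurable_form_square[OF B q]
  have "lincomb B (\<lambda>b\<in>B. 0 + sqrt t * c b) = sqrt t *\<^sub>R lincomb B c" for c
    by (simp add: scaleR_sum_right cong: sum.cong)
  then have *: "?q (\<lambda>b\<in>B. 0 + sqrt t * c b) = t * ?q c" for c
    using t by (simp add: form_square_scale[OF subspace_span q lincomb_in_span])
  have "emeasure ?M {c \<in> space ?M. ?q c \<le> t} = (\<integral>\<^sup>+c. indicator {c \<in> space ?M. ?q c \<le> t} c \<partial>?M)"
    by simp
  also have "\<dots> = (\<Prod>b\<in>B. ennreal \<bar>sqrt t\<bar>) * (\<integral>\<^sup>+c. indicator {c \<in> space ?M. ?q c \<le> t}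
      (\<lambda>b\<in>B. 0 + sqrt t * c b) \<partial>?M)"
    using B t by (intro nn_integral_lborel_on_affine) auto
  also have "(\<integral>\<^sup>+c. indicator {c \<in> space ?M. ?q c \<le> t} (\<lambda>b\<in>B. 0 + sqrt t * c b) \<partial>?M)
      = (\<integral>\<^sup>+c. indicator {c \<in> space ?M. ?q c \<le> 1} c \<partial>?M)"
  proof (intro nn_integral_cong)
    fix c assume "c \<in> space ?M"
    moreover have "(\<lambda>b\<in>B. 0 + sqrt t * c b) \<in> space ?M" by (simp add: space_PiM)
    ultimately show "indicator {c \<in> space ?M. ?q c \<le> t} (\<lambda>b\<in>B. 0 + sqrt t * c b)
      = (indicator {c \<in> space ?M. ?q c \<le> 1} c :: ennreal)"
      using t unfolding indicator_def mem_Collect_eq * by simp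
  qed
  finally show ?thesis using t by (simp add: ennreal_power)
qed

text \<open>Layer-cake formula, with \<open>exp (- s)\<close> as the integral of \<open>exp (- t)\<close> over \<open>t \<ge> s\<close>.\<close>

lemma gauss_eq_volume:
  assumes B: "finite B" and q: "sym_bilinear_on (span B) q"
    and psd: "\<And>x. x \<in> span B \<Longrightarrow> q x x \<ge> 0"
  shows "gauss B q = ennreal (Gamma (real (card B) / 2 + 1))
    * emeasure (lborel_on B) {c \<in> space (lborel_on B). q (lincomb B c) (lincomb B c) \<le> 1}"
proof -
  let ?M = "lborel_on B" let ?q = "\<lambda>c. q (lincomb B c) (lincomb B c)"
  let ?V = "\<lambda>t. emeasure ?M {c \<in> space ?M. ?q c \<le> t}"
  note [measurable] = measurable_form_square[OF B q]
  interpret pair_sigma_finite ?M "lborel :: real measure"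
    using sigma_finite_lborel_on[OF B] sigma_finite_lborel by (intro pair_sigma_finite.intro)
  have tail: "ennreal (exp (- s)) = (\<integral>\<^sup>+t. ennreal (exp (- t)) * indicator {s ..} t \<partial>lborel)" for s :: real
  proof -
    have "(\<integral>\<^sup>+t. ennreal (exp (- t)) * indicator {s ..} t \<partial>lborel) = ennreal (0 - (- exp (- s)))"
    proof (rule nn_integral_FTC_atLeast)
      show "((\<lambda>x::real. - exp (- x)) \<longlongrightarrow> 0) at_top"
        using tendsto_minus[OF filterlim_compose[OF exp_at_bot filterlim_uminus_at_bot_at_top]] by simp
    qed (auto intro!: derivative_eq_intros)
    then show ?thesis by simp
  qed
  have "gauss B q = (\<integral>\<^sup>+c. \<integral>\<^sup>+t. ennreal (exp (- t)) * indicator {?q c ..} t \<partial>lborel \<partial>?M)"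
    unfolding gauss_def by (intro nn_integral_cong tail)
  also have "\<dots> = (\<integral>\<^sup>+t. \<integral>\<^sup>+c. ennreal (exp (- t)) * indicator {?q c ..} t \<partial>?M \<partial>lborel)"
  proof (rule Fubini'[symmetric])
    have "(\<lambda>z. ennreal (exp (- snd z)) * indicator {z \<in> space (?M \<Otimes>\<^sub>M lborel). ?q (fst z) \<le> snd z} z)
      \<in> borel_measurable (?M \<Otimes>\<^sub>M lborel)" by measurable
    then show "(\<lambda>(c, t). ennreal (exp (- t)) * indicator {?q c ..} t) \<in> borel_measurable (?M \<Otimes>\<^sub>M lborel)"
      by (rule measurable_cong[THEN iffD1, rotated]) (auto simp: indicator_def)
  qed
  also have "\<dots> = (\<integral>\<^sup>+t. ennreal (exp (- t)) * ?V t \<partial>lborel)"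
  proof (rule nn_integral_cong)
    fix t :: real
    have "(\<integral>\<^sup>+c. ennreal (exp (- t)) * indicator {?q c ..} t \<partial>?M)
      = (\<integral>\<^sup>+c. ennreal (exp (- t)) * indicator {c \<in> space ?M. ?q c \<le> t} c \<partial>?M)"
      by (intro nn_integral_cong) (auto simp: indicator_def)
    also have "\<dots> = ennreal (exp (- t)) * ?V t"
      by (rule nn_integral_cmult_indicator) measurable
    finally show "(\<integral>\<^sup>+c. ennreal (exp (- t)) * indicator {?q c ..} t \<partial>?M) = ennreal (exp (- t)) * ?V t" .
  qed
  also have "\<dots> = (\<integral>\<^sup>+t. ennreal (indicator {0..} t * t powr (real (card B) / 2 + 1 - 1) / exp t) * ?V 1 \<partial>lborel)"
  proof (rule nn_integral_cong_AE)
    have "AE t in lborel. t \<noteq> (0::real)" by (rule AE_lborel_singleton)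
    then show "AE t in lborel. ennreal (exp (- t)) * ?V t
      = ennreal (indicator {0..} t * t powr (real (card B) / 2 + 1 - 1) / exp t) * ?V 1"
    proof eventually_elim
      fix t :: real assume t0: "t \<noteq> 0"
      show "ennreal (exp (- t)) * ?V t
        = ennreal (indicator {0..} t * t powr (real (card B) / 2 + 1 - 1) / exp t) * ?V 1"
      proof (cases "t > 0")
        case True
        have "sqrt t ^ card B = t powr (real (card B) / 2)"
          using True by (simp add: powr_half_sqrt[symmetric] powr_realpow[symmetric] powr_powr)
        then have "ennreal (exp (- t)) * ?V t
            = ennreal (exp (- t)) * ennreal (t powr (real (card B) / 2)) * ?V 1"
          using ball_in_coordinates_scale[OF B q True] by (simp add: mult.assoc)
        also have "\<dots> = ennreal (exp (- t) * t powr (real (card B) / 2)) * ?V 1"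
          by (simp add: ennreal_mult)
        finally show ?thesis using True by (simp add: exp_minus field_simps)
      next
        case False
        then have "t < 0" using t0 by simp
        then have "\<not> ?q c \<le> t" for c using psd[OF lincomb_in_span[of c B]] by linarith
        then have "{c \<in> space ?M. ?q c \<le> t} = {}" by blast
        then have "?V t = 0" by (simp only: emeasure_empty)
        then show ?thesis using False t0 by (simp add: indicator_def)
      qed
    qed
  qed
  also have "\<dots> = ennreal (Gamma (real (card B) / 2 + 1)) * ?V 1"
    by (subst Gamma_conv_nn_integral_real) (auto intro!: nn_integral_multc)
  finally show ?thesis .
qed

lemma ball_in_coordinates_finite:
  assumes B: "finite B" "independent B" and q: "inner_product_on (span B) q"
  shows "emeasure (lborel_on B) {c \<in> space (lborel_on B). q (lincomb B c) (lincomb B c) \<le> 1} < \<infinity>"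
proof -
  let ?M = "lborel_on B"
  have "\<exists>C. \<forall>c. \<bar>c b\<bar>\<^sup>2 \<le> C * q (lincomb B c) (lincomb B c)" if b: "b \<in> B" for b
  proof -
    have "linear_functional_on (span B) (\<lambda>x. representation B x b)"
      using B(2) by (simp add: linear_functional_on_def representation_add representation_scale)
    then obtain C where C: "\<And>x. x \<in> span B \<Longrightarrow> (representation B x b)\<^sup>2 \<le> C * q x x"
      using linear_functional_on_bounded_by_form[OF B(1) q] by blast
    have rep: "representation B (lincomb B c) b = c b" for c
    proof -
      have "representation B (lincomb B c) b = (\<Sum>i\<in>B. representation B (c i *\<^sub>R i) b)"
        using B(2) by (subst representation_sum) (auto intro: span_scale span_base)
      also have "\<dots> = (\<Sum>i\<in>B. if i = b then c i else 0)"
        using B(2) by (intro sum.cong) (auto simp: representation_scale span_base representation_basis)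
      finally show ?thesis using B(1) b by simp
    qed
    have "\<bar>c b\<bar>\<^sup>2 \<le> C * q (lincomb B c) (lincomb B c)" for c
      using C[OF lincomb_in_span[of c B]] rep[of c] by simp
    then show ?thesis by blast
  qed
  then obtain C where C: "\<And>b c. b \<in> B \<Longrightarrow> \<bar>c b\<bar>\<^sup>2 \<le> C b * q (lincomb B c) (lincomb B c)"
    using bchoice[of B "\<lambda>b C. \<forall>c. \<bar>c b\<bar>\<^sup>2 \<le> C * q (lincomb B c) (lincomb B c)"] by blast
  let ?R = "Pi\<^sub>E B (\<lambda>b. {- (1 + \<bar>C b\<bar>) .. 1 + \<bar>C b\<bar>})"
  have "{c \<in> space ?M. q (lincomb B c) (lincomb B c) \<le> 1} \<subseteq> ?R"
  proof
    fix c assume c: "c \<in> {c \<in> space ?M. q (lincomb B c) (lincomb B c) \<le> 1}"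
    have "c b \<in> {- (1 + \<bar>C b\<bar>) .. 1 + \<bar>C b\<bar>}" if b: "b \<in> B" for b
    proof -
      have "\<bar>c b\<bar>\<^sup>2 \<le> C b * q (lincomb B c) (lincomb B c)" by (rule C[OF b])
      also have "\<dots> \<le> \<bar>C b\<bar> * q (lincomb B c) (lincomb B c)"
        using inner_product_nonneg[OF subspace_span q lincomb_in_span] by (intro mult_right_mono) auto
      also have "\<dots> \<le> \<bar>C b\<bar> * 1" using c by (intro mult_left_mono) auto
      also have "\<dots> \<le> (1 + \<bar>C b\<bar>)\<^sup>2" by (simp add: power2_eq_square algebra_simps)
      finally have "\<bar>c b\<bar> \<le> 1 + \<bar>C b\<bar>" by (rule power2_le_imp_le) simp
      then show ?thesis unfolding atLeastAtMost_iff by linarith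
    qed
    moreover have "c \<in> extensional B" using c by (simp add: space_PiM PiE_iff)
    ultimately show "c \<in> ?R" unfolding PiE_iff by blast
  qed
  then have "emeasure ?M {c \<in> space ?M. q (lincomb B c) (lincomb B c) \<le> 1} \<le> emeasure ?M ?R"
    using B(1) by (intro emeasure_mono sets_PiM_I_finite) auto
  also have "\<dots> = (\<Prod>b\<in>B. emeasure lborel {- (1 + \<bar>C b\<bar>) .. 1 + \<bar>C b\<bar>})"
    by (rule product_sigma_finite.emeasure_PiM[OF product_sigma_finite_lborel B(1)]) simp
  also have "\<dots> = (\<Prod>b\<in>B. ennreal (2 * (1 + \<bar>C b\<bar>)))"
    by (intro prod.cong refl) (simp add: emeasure_lborel_Icc_eq)
  also have "\<dots> < \<infinity>" by (subst prod_ennreal) simp_all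
  finally show ?thesis .
qed

lemma gauss_finite:
  assumes "finite B" "independent B" "inner_product_on (span B) q"
  shows "gauss B q < \<infinity>"
  using ball_in_coordinates_finite[OF assms] inner_product_onD(1)[OF assms(3)]
    inner_product_nonneg[OF subspace_span assms(3)] assms(1)
  by (simp add: gauss_eq_volume ennreal_mult_less_top)

lemma gauss_Un:
  assumes B: "finite B" "finite B'" "B \<inter> B' = {}"
    and q: "sym_bilinear_on (span (B \<union> B')) q"
    and split: "\<And>x y. x \<in> span B \<Longrightarrow> y \<in> span B' \<Longrightarrow> q (x + y) (x + y) = q x x + q y y"
  shows "gauss (B \<union> B') q = gauss B q * gauss B' q"
proof -
  have qB: "sym_bilinear_on (span B) q" and qB': "sym_bilinear_on (span B') q"
    using q by (auto elim!: sym_bilinear_on_mono intro!: span_mono)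
  have fU: "finite (B \<union> B')" using B by simp
  note [measurable] = measurable_form_square[OF B(1) qB] measurable_form_square[OF B(2) qB']
    measurable_form_square[OF fU q]
  let ?e = "\<lambda>x. ennreal (exp (- q x x))"
  have "gauss (B \<union> B') q = (\<integral>\<^sup>+c. \<integral>\<^sup>+d. ?e (lincomb (B \<union> B') (merge B B' (c, d))) \<partial>lborel_on B' \<partial>lborel_on B)"
    unfolding gauss_def
    by (rule product_sigma_finite.product_nn_integral_fold[OF product_sigma_finite_lborel B(3,1,2)])
      measurable
  also have "\<dots> = (\<integral>\<^sup>+c. \<integral>\<^sup>+d. ?e (lincomb B c) * ?e (lincomb B' d) \<partial>lborel_on B' \<partial>lborel_on B)"
  proof (intro nn_integral_cong)
    fix c d :: "'a \<Rightarrow> real"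
    have "lincomb (B \<union> B') (merge B B' (c, d)) = lincomb B c + lincomb B' d"
    proof -
      have "lincomb B (merge B B' (c, d)) = lincomb B c"
        by (intro sum.cong) (auto simp: merge_def)
      moreover have "lincomb B' (merge B B' (c, d)) = lincomb B' d"
        using B(3) by (intro sum.cong) (auto simp: merge_def)
      ultimately show ?thesis using B by (simp add: sum.union_disjoint)
    qed
    then show "?e (lincomb (B \<union> B') (merge B B' (c, d))) = ?e (lincomb B c) * ?e (lincomb B' d)"
      using split[OF lincomb_in_span lincomb_in_span, of c d]
      by (simp flip: ennreal_mult' exp_add)
  qed
  also have "\<dots> = gauss B q * gauss B' q"
    unfolding gauss_def by (simp add: nn_integral_cmult nn_integral_multc)
  finally show ?thesis .
qed

lemma gauss_reflect:
  assumes B: "finite B" "finite B'" "B \<inter> B' = {}"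
    and q: "sym_bilinear_on (span (B \<union> B')) q"
    and refl: "\<And>x y. x \<in> span B \<Longrightarrow> y \<in> span B' \<Longrightarrow> q' (x + y) (x + y) = q (x - y) (x - y)"
  shows "gauss (B \<union> B') q' = gauss (B \<union> B') q"
proof -
  have fU: "finite (B \<union> B')" using B by simp
  note [measurable] = measurable_form_square[OF fU q]
  \<comment> \<open>In the coordinates of \<open>B \<union> B'\<close> the reflection only changes signs, which preserves the measure.\<close>
  let ?s = "\<lambda>b. if b \<in> B then 1 else - 1 :: real"
  have "q (lincomb (B \<union> B') (\<lambda>b\<in>B \<union> B'. 0 + ?s b * c b)) (lincomb (B \<union> B') (\<lambda>b\<in>B \<union> B'. 0 + ?s b * c b))
    = q' (lincomb (B \<union> B') c) (lincomb (B \<union> B') c)" for c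
  proof -
    have 1: "lincomb B (\<lambda>b\<in>B \<union> B'. 0 + ?s b * c b) = lincomb B c"
      by (intro sum.cong) auto
    have "lincomb B' (\<lambda>b\<in>B \<union> B'. 0 + ?s b * c b) = (\<Sum>b\<in>B'. - (c b *\<^sub>R b))"
      using B(3) by (intro sum.cong) auto
    then have 2: "lincomb B' (\<lambda>b\<in>B \<union> B'. 0 + ?s b * c b) = - lincomb B' c" by (simp add: sum_negf)
    show ?thesis
      unfolding sum.union_disjoint[OF B] 1 2 refl[OF lincomb_in_span lincomb_in_span] by simp
  qed
  then show ?thesis
    unfolding gauss_def
    by (subst (2) nn_integral_lborel_on_affine[OF fU, of ?s _ "\<lambda>_. 0"])
      (simp_all add: if_distrib[of abs] cong: if_cong)
qed

text \<open>A form that vanishes almost everywhere also vanishes almost everywhere after translation by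
  \<open>\<plusminus>x\<close>; then the parallelogram law gives its value at \<open>x\<close>.\<close>

lemma form_AE_zero:
  assumes B: "finite B" and d: "sym_bilinear_on (span B) d"
    and ae: "AE c in lborel_on B. d (lincomb B c) (lincomb B c) = 0" and x: "x \<in> span B"
  shows "d x x = 0"
proof -
  let ?M = "lborel_on B"
  note [measurable] = measurable_form_square[OF B d]
  have tr: "AE c in ?M. d (lincomb B c + y) (lincomb B c + y) = 0" if y: "y \<in> span B" for y
  proof -
    let ?h = "\<lambda>z. if d z z = 0 then 0 else 1 :: ennreal"
    have "(\<integral>\<^sup>+c. ?h (lincomb B c + y) \<partial>?M) = (\<integral>\<^sup>+c. ?h (lincomb B c) \<partial>?M)"
      using y B by (intro nn_integral_lincomb_translate) measurable
    also have "\<dots> = (\<integral>\<^sup>+c. 0 \<partial>?M)"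
      by (rule nn_integral_cong_AE) (use ae in eventually_elim, simp)
    finally have 0: "(\<integral>\<^sup>+c. ?h (lincomb B c + y) \<partial>?M) = 0" by simp
    obtain a where a: "y = lincomb B (restrict a B)"
      using y B by (auto simp: span_finite cong: sum.cong)
    have "restrict a B \<in> space ?M" by (simp add: space_PiM)
    then have [measurable]: "(\<lambda>c. d (lincomb B c + y) (lincomb B c + y)) \<in> borel_measurable ?M"
      using measurable_form_square_add[OF B B refl d measurable_ident measurable_const,
          of "restrict a B"] by (simp add: id_def a)
    have "AE c in ?M. ?h (lincomb B c + y) = 0"
      using 0 by (subst (asm) nn_integral_0_iff_AE) measurable
    then show ?thesis by eventually_elim (simp split: if_splits)
  qed
  have "AE c in ?M. d x x = 0"
    using ae tr[OF x] tr[OF span_neg[OF x]]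
  proof eventually_elim
    fix c assume "d (lincomb B c) (lincomb B c) = 0" "d (lincomb B c + x) (lincomb B c + x) = 0"
      "d (lincomb B c + - x) (lincomb B c + - x) = 0"
    then show "d x x = 0"
      using form_square_add[OF subspace_span d lincomb_in_span[of c B] x]
        form_square_diff[OF subspace_span d lincomb_in_span[of c B] x] by simp
  qed
  then show ?thesis
    using emeasure_lborel_on_UNIV[OF B]
    by (cases "d x x = 0") (simp_all add: AE_iff_measurable[OF _ refl])
qed

text \<open>Strict convexity of the Gaussian integral, from \<open>a\<^sup>2 + b\<^sup>2 = (a - b)\<^sup>2 + 2 a b\<close> with
  \<open>a = exp (- q1 / 2)\<close> and \<open>b = exp (- q2 / 2)\<close>.\<close>

lemma gauss_midpoint:
  assumes B: "finite B" "independent B"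
    and q1: "inner_product_on (span B) q1" and q2: "inner_product_on (span B) q2"
    and le: "gauss B q1 + gauss B q2 \<le> 2 * gauss B (\<lambda>x y. (q1 x y + q2 x y) / 2)"
    and x: "x \<in> span B"
  shows "q1 x x = q2 x x"
proof -
  let ?M = "lborel_on B" let ?q1 = "\<lambda>c. q1 (lincomb B c) (lincomb B c)"
    and ?q2 = "\<lambda>c. q2 (lincomb B c) (lincomb B c)"
  note s1 = inner_product_onD(1)[OF q1] and s2 = inner_product_onD(1)[OF q2]
  note [measurable] = measurable_form_square[OF B(1) s1] measurable_form_square[OF B(1) s2]
  let ?m = "\<lambda>x y. (q1 x y + q2 x y) / 2"
  let ?D = "\<integral>\<^sup>+c. ennreal ((exp (- ?q1 c / 2) - exp (- ?q2 c / 2))\<^sup>2) \<partial>?M"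
  have "exp (- s) + exp (- t) = (exp (- s / 2) - exp (- t / 2))\<^sup>2 + 2 * exp (- ((s + t) / 2))" for s t :: real
  proof -
    have "exp (- s) = exp (- s / 2) * exp (- s / 2)" "exp (- t) = exp (- t / 2) * exp (- t / 2)"
      "exp (- ((s + t) / 2)) = exp (- s / 2) * exp (- t / 2)"
      by (simp_all flip: exp_add add: field_simps)
    then show ?thesis by (simp add: power2_eq_square algebra_simps)
  qed
  then have *: "ennreal (exp (- s)) + ennreal (exp (- t))
      = ennreal ((exp (- s / 2) - exp (- t / 2))\<^sup>2) + 2 * ennreal (exp (- ((s + t) / 2)))" for s t :: real
    by (simp add: ennreal_plus[symmetric] ennreal_mult del: ennreal_plus)
      (simp add: ennreal_mult)
  have "gauss B q1 + gauss B q2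
      = (\<integral>\<^sup>+c. ennreal (exp (- ?q1 c)) + ennreal (exp (- ?q2 c)) \<partial>?M)"
    unfolding gauss_def by (rule nn_integral_add[symmetric]) measurable
  also have "\<dots> = ?D + 2 * gauss B ?m"
    unfolding gauss_def * by (simp add: nn_integral_add nn_integral_cmult)
  finally have "2 * gauss B ?m + ?D \<le> 2 * gauss B ?m + 0" using le by (simp add: add.commute)
  moreover have "gauss B ?m < \<infinity>"
    using q1 q2 by (intro gauss_finite[OF B])
      (auto simp: inner_product_on_def linear_functional_on_def field_simps intro!: add_pos_pos)
  ultimately have "?D \<le> 0"
    using ennreal_add_left_cancel_le[of "2 * gauss B ?m" ?D 0] by (auto simp: ennreal_mult_eq_top_iff)
  then have "?D = 0" by simp
  then have "AE c in ?M. ennreal ((exp (- ?q1 c / 2) - exp (- ?q2 c / 2))\<^sup>2) = 0"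
    by (subst (asm) nn_integral_0_iff_AE) auto
  then have "AE c in ?M. (\<lambda>x y. q1 x y - q2 x y) (lincomb B c) (lincomb B c) = 0"
    by eventually_elim (simp add: ennreal_eq_0_iff)
  moreover have "sym_bilinear_on (span B) (\<lambda>x y. q1 x y - q2 x y)"
    using s1 s2 by (simp add: sym_bilinear_on_def linear_functional_on_def algebra_simps)
  ultimately show ?thesis using form_AE_zero[OF B(1) _ _ x, of "\<lambda>x y. q1 x y - q2 x y"] by simp
qed

section \<open>Extremal forms\<close>

definition norm_dominated :: "'a::real_normed_vector set \<Rightarrow> ('a \<Rightarrow> 'a \<Rightarrow> real) \<Rightarrow> bool" where
  "norm_dominated G q \<longleftrightarrow> inner_product_on G q \<and> (\<forall>x\<in>G. q x x \<le> (norm x)\<^sup>2)"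

text \<open>The ellipsoid \<open>{x. q x x \<le> 1}\<close> contains the unit ball exactly if \<open>q\<close> is dominated by the squared
  norm, so that these are the forms of the ellipsoids of minimum volume.\<close>

definition extremal :: "'a::real_normed_vector set \<Rightarrow> ('a \<Rightarrow> 'a \<Rightarrow> real) \<Rightarrow> bool" where
  "extremal B q \<longleftrightarrow> norm_dominated (span B) q \<and>
     (\<forall>q'. norm_dominated (span B) q' \<longrightarrow> gauss B q \<le> gauss B q')"

lemma norm_dominatedD:
  assumes "norm_dominated G q"
  shows "inner_product_on G q" "sym_bilinear_on G q" "\<And>x. x \<in> G \<Longrightarrow> q x x \<le> (norm x)\<^sup>2"
  using assms inner_product_onD(1) by (auto simp: norm_dominated_def)

lemma extremalD:
  assumes "extremal B q"
  shows "norm_dominated (span B) q" "\<And>q'. norm_dominated (span B) q' \<Longrightarrow> gauss B q \<le> gauss B q'"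
  using assms by (auto simp: extremal_def)

text \<open>Dominated forms form a convex set, on which the Gaussian integral is strictly convex.\<close>

lemma extremal_unique:
  assumes B: "finite B" "independent B" and q1: "extremal B q1" and q2: "extremal B q2"
    and x: "x \<in> span B"
  shows "q1 x x = q2 x x"
proof -
  let ?m = "\<lambda>x y. (q1 x y + q2 x y) / 2"
  note d1 = norm_dominatedD[OF extremalD(1)[OF q1]] and d2 = norm_dominatedD[OF extremalD(1)[OF q2]]
  have "norm_dominated (span B) ?m"
    unfolding norm_dominated_def
  proof (intro conjI ballI inner_product_onI)
    show "sym_bilinear_on (span B) ?m"
      using d1(2) d2(2) by (simp add: sym_bilinear_on_def linear_functional_on_def field_simps)
    show "?m y y > 0" if "y \<in> span B" "y \<noteq> 0" for y
      using inner_product_onD(2)[OF d1(1) that] inner_product_onD(2)[OF d2(1) that] by simp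
    show "?m y y \<le> (norm y)\<^sup>2" if "y \<in> span B" for y
      using d1(3)[OF that] d2(3)[OF that] by simp
  qed
  then have "gauss B q1 + gauss B q2 \<le> gauss B ?m + gauss B ?m"
    by (intro add_mono extremalD(2)[OF q1] extremalD(2)[OF q2])
  then show ?thesis
    by (intro gauss_midpoint[OF B d1(1) d2(1) _ x]) (simp add: mult_2)
qed

lemma extremal_change_basis:
  assumes B: "finite B" "independent B" and B': "finite B'" "independent B'" "span B' = span B"
    and q: "extremal B q"
  shows "extremal B' q"
  unfolding extremal_def B'(3)
proof (intro conjI allI impI)
  show d: "norm_dominated (span B) q" by (rule extremalD(1)[OF q])
  fix q' assume d': "norm_dominated (span B) q'"
  have "gauss B q' * gauss B' q = gauss B q * gauss B' q'"
    using gauss_change_basis[OF B(1) B'(1,3) norm_dominatedD(2)[OF d] norm_dominatedD(2)[OF d']]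
    by (simp add: mult.commute)
  also have "\<dots> \<le> gauss B q' * gauss B' q'"
    by (intro mult_right_mono extremalD(2)[OF q] d') simp
  finally show "gauss B' q \<le> gauss B' q'"
    using gauss_pos[OF B(1) norm_dominatedD(2)[OF d']] gauss_finite[OF B norm_dominatedD(1)[OF d']]
    by (simp add: ennreal_mult_le_mult_iff)
qed

lemma convergent_subsequence_finite:
  fixes f :: "nat \<Rightarrow> 'i \<Rightarrow> real"
  assumes "finite I" "\<And>n i. i \<in> I \<Longrightarrow> \<bar>f n i\<bar> \<le> C i"
  shows "\<exists>r. strict_mono (r :: nat \<Rightarrow> nat) \<and> (\<forall>i\<in>I. convergent (\<lambda>n. f (r n) i))"
  using assms
proof (induction I rule: finite_induct)
  case empty
  then show ?case using strict_mono_id by blast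
next
  case (insert i I)
  then obtain r where r: "strict_mono (r :: nat \<Rightarrow> nat)" "\<And>j. j \<in> I \<Longrightarrow> convergent (\<lambda>n. f (r n) j)"
    by auto
  have "bounded (range (\<lambda>n. f (r n) i))"
    using insert.prems by (intro boundedI[where B = "C i"]) auto
  then obtain l s where s: "strict_mono (s :: nat \<Rightarrow> nat)" "((\<lambda>n. f (r n) i) \<circ> s) \<longlonglongrightarrow> l"
    using bounded_imp_convergent_subsequence by blast
  have "convergent (\<lambda>n. f (r (s n)) j)" if "j \<in> insert i I" for j
  proof (cases "j = i")
    case True
    then show ?thesis using s(2) by (auto simp: convergent_def o_def)
  next
    case False
    then show ?thesis
      using r(2)[of j] that convergent_subseq_convergent[OF _ s(1), of "\<lambda>n. f (r n) j"] by (auto simp: o_def)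
  qed
  then show ?case using strict_mono_o[OF r(1) s(1)] by (auto simp: o_def)
qed

text \<open>Otherwise coefficient vectors of Euclidean length \<open>1\<close> with combinations tending to \<open>0\<close> would
  subconverge to a nontrivial linear relation.\<close>

lemma norm_lincomb_lower_bound:
  fixes B :: "'a::real_normed_vector set"
  assumes B: "finite B" "independent B"
  obtains d where "d > 0" "\<And>c. d * (\<Sum>b\<in>B. (c b)\<^sup>2) \<le> (norm (lincomb B c))\<^sup>2"
proof (rule ccontr)
  assume "\<not> thesis"
  then have no: "\<not> (\<forall>c. 1 / real (Suc n) * (\<Sum>b\<in>B. (c b)\<^sup>2) \<le> (norm (lincomb B c))\<^sup>2)" for n
    using that[of "1 / real (Suc n)"] by auto
  have "\<exists>c. (\<Sum>b\<in>B. (c b)\<^sup>2) = 1 \<and> (norm (lincomb B c))\<^sup>2 \<le> 1 / real (Suc n)" for n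
  proof -
    obtain c where c: "(norm (lincomb B c))\<^sup>2 < 1 / real (Suc n) * (\<Sum>b\<in>B. (c b)\<^sup>2)"
      using no[of n] by (auto simp: not_le)
    define s where "s = (\<Sum>b\<in>B. (c b)\<^sup>2)"
    have "0 < 1 / real (Suc n) * s"
      using c by (intro order.strict_trans1[OF zero_le_power2[of "norm (lincomb B c)"]]) (simp add: s_def)
    then have s: "s > 0" by (simp add: zero_less_mult_iff zero_less_divide_iff)
    have "lincomb B (\<lambda>b. c b / sqrt s) = (1 / sqrt s) *\<^sub>R lincomb B c"
      by (simp add: scaleR_sum_right)
    then have "(norm (lincomb B (\<lambda>b. c b / sqrt s)))\<^sup>2 = (norm (lincomb B c))\<^sup>2 / s"
      using s by (simp add: power_divide)
    also have "\<dots> \<le> 1 / real (Suc n)" using c s by (simp add: s_def[symmetric] field_simps)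
    finally have "(norm (lincomb B (\<lambda>b. c b / sqrt s)))\<^sup>2 \<le> 1 / real (Suc n)" .
    moreover have "(\<Sum>b\<in>B. (c b / sqrt s)\<^sup>2) = 1"
      using s by (simp add: power_divide flip: sum_divide_distrib s_def)
    ultimately show ?thesis by (intro exI[of _ "\<lambda>b. c b / sqrt s"] conjI)
  qed
  then obtain c where c: "\<And>n. (\<Sum>b\<in>B. (c n b)\<^sup>2) = 1"
      "\<And>n. (norm (lincomb B (c n)))\<^sup>2 \<le> 1 / real (Suc n)"
    by metis
  have "\<bar>c n b\<bar> \<le> 1" if "b \<in> B" for n b
  proof -
    have "(c n b)\<^sup>2 \<le> (\<Sum>b\<in>B. (c n b)\<^sup>2)"
      using that B by (intro member_le_sum) auto
    then show ?thesis using c(1) by (simp add: abs_square_le_1)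
  qed
  then obtain r where r: "strict_mono (r :: nat \<Rightarrow> nat)" "\<And>b. b \<in> B \<Longrightarrow> convergent (\<lambda>n. c (r n) b)"
    using convergent_subsequence_finite[OF B(1), of c "\<lambda>_. 1"] by blast
  define l where "l b = lim (\<lambda>n. c (r n) b)" for b
  have l: "(\<lambda>n. c (r n) b) \<longlonglongrightarrow> l b" if "b \<in> B" for b
    using r(2)[OF that] by (simp add: l_def convergent_LIMSEQ_iff)
  have "(\<lambda>n. (norm (lincomb B (c (r n))))\<^sup>2) \<longlonglongrightarrow> (norm (lincomb B l))\<^sup>2"
    by (intro tendsto_intros l)
  moreover have "(\<lambda>n. 1 / real (Suc (r n))) \<longlonglongrightarrow> 0"
    using LIMSEQ_subseq_LIMSEQ[OF LIMSEQ_inverse_real_of_nat r(1)] by (simp add: o_def inverse_eq_divide)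
  ultimately have "(norm (lincomb B l))\<^sup>2 \<le> 0"
    by (rule LIMSEQ_le) (use c(2) in auto)
  then have "lincomb B l = 0" by simp
  then have "l b = 0" if "b \<in> B" for b
    using B that by (metis independentD order_refl)
  moreover have "(\<lambda>n. \<Sum>b\<in>B. (c (r n) b)\<^sup>2) \<longlonglongrightarrow> (\<Sum>b\<in>B. (l b)\<^sup>2)"
    by (intro tendsto_intros l)
  ultimately show False using c(1) by (simp add: LIMSEQ_const_iff)
qed

lemma norm_dominated_exists:
  fixes B :: "'a::real_normed_vector set"
  assumes B: "finite B" "independent B"
  shows "\<exists>q. norm_dominated (span B) q"
proof -
  obtain d where d: "d > 0" "\<And>c. d * (\<Sum>b\<in>B. (c b)\<^sup>2) \<le> (norm (lincomb B c))\<^sup>2"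
    using norm_lincomb_lower_bound[OF B] by blast
  let ?r = "representation B"
  define q where "q x y = d * (\<Sum>b\<in>B. ?r x b * ?r y b)" for x y
  have x: "lincomb B (?r x) = x" if "x \<in> span B" for x
    using B that by (intro sum_representation_eq) auto
  have "norm_dominated (span B) q"
    unfolding norm_dominated_def
  proof (intro conjI ballI inner_product_onI sym_bilinear_onI)
    show "q (x + y) z = q x z + q y z" if "x \<in> span B" "y \<in> span B" for x y z
      using B(2) that by (simp add: q_def representation_add algebra_simps sum.distrib)
    show "q (a *\<^sub>R x) z = a * q x z" if "x \<in> span B" for a x z
      using B(2) that by (simp add: q_def representation_scale sum_distrib_left algebra_simps)
    show "q x y = q y x" for x y by (simp add: q_def mult.commute)
    show "q y y \<le> (norm y)\<^sup>2" if "y \<in> span B" for y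
      using d(2)[of "?r y"] x[OF that] by (simp add: q_def power2_eq_square)
    show "q y y > 0" if y: "y \<in> span B" "y \<noteq> 0" for y
    proof -
      obtain b where b: "b \<in> B" "?r y b \<noteq> 0"
        using x[OF y(1)] y(2) by (metis (no_types, lifting) scaleR_eq_0_iff sum.neutral)
      have "0 < (\<Sum>b\<in>B. ?r y b * ?r y b)"
        using b B(1) by (intro sum_pos2[of B b]) (auto simp: zero_less_mult_iff)
      then show ?thesis using d(1) by (simp add: q_def)
    qed
  qed
  then show ?thesis by blast
qed

text \<open>Forms dominated by the squared norm are bounded, so a minimising sequence subconverges to a form
  which by Fatou's lemma has the infimum as its Gaussian integral. The limit is definite because
  the infimum is finite.\<close>

lemma extremal_exists:
  fixes B :: "'a::real_normed_vector set"
  assumes B: "finite B" "independent B"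
  obtains q where "extremal B q"
proof -
  let ?S = "span B" let ?A = "gauss B ` {q. norm_dominated ?S q}"
  have "?A \<noteq> {}" using norm_dominated_exists[OF B] by auto
  from ennreal_Inf_countable_INF[OF this] obtain g :: "nat \<Rightarrow> ennreal"
    where g: "decseq g" "range g \<subseteq> ?A" "Inf ?A = (INF i. g i)" by (elim exE conjE)
  have "\<exists>q. norm_dominated ?S q \<and> gauss B q = g n" for n
  proof -
    have "g n \<in> ?A" using g(2) by (rule subsetD) simp
    then show ?thesis by auto
  qed
  then obtain q where q: "\<And>n. norm_dominated ?S (q n)" "\<And>n. gauss B (q n) = g n"
    by metis
  note qs = norm_dominatedD(2)[OF q(1)]
  have "\<bar>q n (fst p) (snd p)\<bar> \<le> norm (fst p) * norm (snd p)" if "p \<in> B \<times> B" for n p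
  proof -
    have p: "fst p \<in> ?S" "snd p \<in> ?S" using that by (auto intro: span_base)
    have nn: "x \<in> ?S \<Longrightarrow> 0 \<le> q n x x" for x
      by (rule inner_product_nonneg[OF subspace_span norm_dominatedD(1)[OF q(1)]])
    have "(q n (fst p) (snd p))\<^sup>2 \<le> q n (fst p) (fst p) * q n (snd p) (snd p)"
      by (rule form_Cauchy_Schwarz[OF subspace_span qs nn p])
    also have "\<dots> \<le> (norm (fst p))\<^sup>2 * (norm (snd p))\<^sup>2"
      using p nn by (intro mult_mono norm_dominatedD(3)[OF q(1)]) auto
    finally have "\<bar>q n (fst p) (snd p)\<bar>\<^sup>2 \<le> (norm (fst p) * norm (snd p))\<^sup>2"
      by (simp add: power_mult_distrib)
    then show ?thesis by (rule power2_le_imp_le) simp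
  qed
  then obtain r where r: "strict_mono (r :: nat \<Rightarrow> nat)"
      "\<And>p. p \<in> B \<times> B \<Longrightarrow> convergent (\<lambda>n. q (r n) (fst p) (snd p))"
    using convergent_subsequence_finite[of "B \<times> B" "\<lambda>n p. q n (fst p) (snd p)"
        "\<lambda>p. norm (fst p) * norm (snd p)"] B(1) by blast
  define Q where "Q x y = lim (\<lambda>n. q (r n) x y)" for x y
  have Q: "(\<lambda>n. q (r n) x y) \<longlonglongrightarrow> Q x y" if xy: "x \<in> ?S" "y \<in> ?S" for x y
  proof -
    obtain c d where cd: "x = lincomb B c" "y = lincomb B d"
      using xy B(1) by (auto simp: span_finite)
    have "(\<lambda>n. q (r n) x y) = (\<lambda>n. \<Sum>b\<in>B. \<Sum>b'\<in>B. c b * d b' * q (r n) b b')"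
      unfolding cd using B(1) by (intro ext form_lin_comb[OF subspace_span qs]) (auto intro: span_base)
    moreover have "(\<lambda>n. q (r n) b b') \<longlonglongrightarrow> Q b b'" if "b \<in> B" "b' \<in> B" for b b'
      using r(2)[of "(b, b')"] that by (simp add: Q_def convergent_LIMSEQ_iff)
    then have "(\<lambda>n. \<Sum>b\<in>B. \<Sum>b'\<in>B. c b * d b' * q (r n) b b')
        \<longlonglongrightarrow> (\<Sum>b\<in>B. \<Sum>b'\<in>B. c b * d b' * Q b b')"
      by (intro tendsto_sum tendsto_mult_left)
    ultimately have "convergent (\<lambda>n. q (r n) x y)" unfolding convergent_def by metis
    then show ?thesis by (simp add: Q_def convergent_LIMSEQ_iff)
  qed
  have Qs: "sym_bilinear_on ?S Q"
  proof (rule sym_bilinear_onI)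
    fix x y z assume S: "x \<in> ?S" "y \<in> ?S" "z \<in> ?S"
    have "(\<lambda>n. q (r n) (x + y) z) \<longlonglongrightarrow> Q x z + Q y z"
      using tendsto_add[OF Q[OF S(1,3)] Q[OF S(2,3)]] by (simp add: form_add[OF subspace_span qs S])
    then show "Q (x + y) z = Q x z + Q y z"
      using Q[OF span_add[OF S(1,2)] S(3)] LIMSEQ_unique by blast
  next
    fix a x z assume S: "x \<in> ?S" "z \<in> ?S"
    have "(\<lambda>n. q (r n) (a *\<^sub>R x) z) \<longlonglongrightarrow> a * Q x z"
      using tendsto_mult_left[OF Q[OF S]] by (simp add: form_scale[OF subspace_span qs S])
    then show "Q (a *\<^sub>R x) z = a * Q x z"
      using Q[OF span_scale[OF S(1)] S(2)] LIMSEQ_unique by blast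
  next
    fix x y assume S: "x \<in> ?S" "y \<in> ?S"
    show "Q x y = Q y x" unfolding Q_def by (simp add: form_sym[OF subspace_span qs S])
  qed
  have psd: "Q x x \<ge> 0" if "x \<in> ?S" for x
    using Q[OF that that] by (rule LIMSEQ_le_const)
      (use inner_product_nonneg[OF subspace_span norm_dominatedD(1)[OF q(1)] that] in auto)
  have dom: "Q x x \<le> (norm x)\<^sup>2" if "x \<in> ?S" for x
    using Q[OF that that] by (rule LIMSEQ_le_const2) (use norm_dominatedD(3)[OF q(1) that] in auto)
  have glim: "(\<lambda>n. g (r n)) \<longlonglongrightarrow> Inf ?A"
    using LIMSEQ_subseq_LIMSEQ[OF LIMSEQ_INF[OF g(1)] r(1)] g(3) by (simp add: o_def)
  have "gauss B Q \<le> Inf ?A"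
  proof -
    let ?e = "\<lambda>n c. ennreal (exp (- q (r n) (lincomb B c) (lincomb B c)))"
    have "gauss B Q = (\<integral>\<^sup>+c. liminf (\<lambda>n. ?e n c) \<partial>lborel_on B)"
      unfolding gauss_def
    proof (intro nn_integral_cong)
      fix c
      have "(\<lambda>n. ?e n c) \<longlonglongrightarrow> ennreal (exp (- Q (lincomb B c) (lincomb B c)))"
        by (intro tendsto_ennrealI tendsto_intros Q lincomb_in_span)
      then show "ennreal (exp (- Q (lincomb B c) (lincomb B c))) = liminf (\<lambda>n. ?e n c)"
        by (rule lim_imp_Liminf[OF trivial_limit_sequentially, symmetric])
    qed
    also have "\<dots> \<le> liminf (\<lambda>n. \<integral>\<^sup>+c. ?e n c \<partial>lborel_on B)"
    proof (rule nn_integral_liminf)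
      fix n
      note [measurable] = measurable_form_square[OF B(1) qs[of "r n"]]
      show "?e n \<in> borel_measurable (lborel_on B)" by measurable
    qed
    also have "\<dots> = liminf (\<lambda>n. g (r n))" using q(2) by (simp add: gauss_def)
    also have "\<dots> = Inf ?A" using glim by (simp add: lim_imp_Liminf)
    finally show ?thesis .
  qed
  note min = order_trans[OF this Inf_lower]
  have "gauss B Q \<noteq> \<infinity>"
    using min[of "gauss B (q 0)"] q(1) gauss_finite[OF B norm_dominatedD(1)[OF q(1)], of 0]
    by (auto simp: top_unique)
  then have "Q x x \<noteq> 0" if "x \<in> ?S" "x \<noteq> 0" for x
    using gauss_degenerate[OF B Qs psd that] by blast
  then have "inner_product_on ?S Q"
    using psd by (intro inner_product_onI Qs) (simp add: less_le)
  then have "extremal B Q"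
    unfolding extremal_def norm_dominated_def using dom min by (auto simp: norm_dominated_def)
  then show ?thesis by (rule that)
qed

section \<open>The minimum volume ellipsoid is given by the extremal form\<close>

lemma basis_of_finite_dim:
  assumes "subspace G" "finite_dim G"
  shows "finite (basis_of G)" "independent (basis_of G)" "span (basis_of G) = G"
proof -
  obtain B where "B \<subseteq> G" "independent B" "G \<subseteq> span B" by (rule maximal_independent_subset)
  then have "\<exists>B. independent B \<and> span B = G"
    using assms(1) by (metis span_minimal subset_antisym)
  from someI_ex[OF this] show b: "independent (basis_of G)" "span (basis_of G) = G"
    by (auto simp: basis_of_def)
  obtain A where "finite A" "span A = G" using assms(2) by (auto simp: finite_dim_def)
  then show "finite (basis_of G)"
    using independent_span_bound[of A "basis_of G"] b span_superset[of "basis_of G"] by auto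
qed

lemma ball_subset_ellipsoid_iff:
  assumes G: "subspace G" and q: "sym_bilinear_on G q"
  shows "cball 0 1 \<inter> G \<subseteq> {x \<in> G. q x x \<le> 1} \<longleftrightarrow> (\<forall>x\<in>G. q x x \<le> (norm x)\<^sup>2)"
proof
  assume sub: "cball 0 1 \<inter> G \<subseteq> {x \<in> G. q x x \<le> 1}"
  show "\<forall>x\<in>G. q x x \<le> (norm x)\<^sup>2"
  proof
    fix x assume x: "x \<in> G"
    show "q x x \<le> (norm x)\<^sup>2"
    proof (cases "x = 0")
      case True
      then show ?thesis using form_zero[OF G q x] by simp
    next
      case False
      then have "(1 / norm x) *\<^sub>R x \<in> cball 0 1 \<inter> G" using x G by (simp add: subspace_scale)
      then have "q ((1 / norm x) *\<^sub>R x) ((1 / norm x) *\<^sub>R x) \<le> 1" using sub by blast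
      then show ?thesis
        using False by (simp add: form_square_scale[OF G q x] power_divide)
    qed
  qed
next
  assume dom: "\<forall>x\<in>G. q x x \<le> (norm x)\<^sup>2"
  have "q x x \<le> 1" if "x \<in> G" "norm x \<le> 1" for x
    using dom that power_le_one[of "norm x" 2] by fastforce
  then show "cball 0 1 \<inter> G \<subseteq> {x \<in> G. q x x \<le> 1}" by auto
qed

lemma volume_in_le_iff_gauss_le:
  assumes G: "subspace G" "finite_dim G" and q: "inner_product_on G q" and q': "inner_product_on G q'"
  shows "volume_in G {x \<in> G. q x x \<le> 1} \<le> volume_in G {x \<in> G. q' x x \<le> 1}
    \<longleftrightarrow> gauss (basis_of G) q \<le> gauss (basis_of G) q'"
proof -
  note b = basis_of_finite_dim[OF G]
  have "gauss (basis_of G) p = ennreal (Gamma (real (card (basis_of G)) / 2 + 1)) * volume_in G {x \<in> G. p x x \<le> 1}"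
    if p: "inner_product_on G p" for p
  proof -
    have "lincomb (basis_of G) c \<in> G" for c using lincomb_in_span[of c "basis_of G"] b by simp
    then show ?thesis
      using gauss_eq_volume[OF b(1), of p] inner_product_onD(1)[OF p] inner_product_nonneg[OF G(1) p] b
      by (simp add: volume_in_def Let_def)
  qed
  moreover have "Gamma (real (card (basis_of G)) / 2 + 1) > 0"
    by (intro Gamma_real_pos) (simp add: add_nonneg_pos)
  then have "ennreal (Gamma (real (card (basis_of G)) / 2 + 1)) \<noteq> 0"
    unfolding ennreal_eq_0_iff not_le .
  ultimately show ?thesis using q q' by (simp add: ennreal_mult_le_mult_iff)
qed

text \<open>The definition of the volume prescribes a basis, but extremality may be tested in any other one:
  both the change of basis and the passage from volumes to Gaussian integrals only cost a factor.\<close>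

lemma min_ellipsoid_eq:
  assumes B: "finite B" "independent B" and q: "extremal B q"
  shows "min_ellipsoid (span B) = {x \<in> span B. q x x \<le> 1}"
proof -
  let ?G = "span B" let ?b = "basis_of ?G"
  have G: "subspace ?G" "finite_dim ?G" using B by (auto simp: finite_dim_def)
  note b = basis_of_finite_dim[OF G]
  have ex: "extremal ?b q" by (rule extremal_change_basis[OF B b q])
  have d: "norm_dominated ?G q" using extremalD(1)[OF q] .
  show ?thesis
    unfolding min_ellipsoid_def
  proof (rule the_equality, intro conjI allI impI)
    show "ellipsoid_in ?G {x \<in> ?G. q x x \<le> 1}"
      using d by (auto simp: ellipsoid_in_def norm_dominated_def)
    show "cball 0 1 \<inter> ?G \<subseteq> {x \<in> ?G. q x x \<le> 1}"
      using d ball_subset_ellipsoid_iff[OF G(1) norm_dominatedD(2)[OF d]] by (simp add: norm_dominated_def)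
    fix S' assume S': "ellipsoid_in ?G S' \<and> cball 0 1 \<inter> ?G \<subseteq> S'"
    then obtain q' where q': "inner_product_on ?G q'" "S' = {x \<in> ?G. q' x x \<le> 1}"
      by (auto simp: ellipsoid_in_def)
    have "norm_dominated ?G q'"
      using S' q' ball_subset_ellipsoid_iff[OF G(1) inner_product_onD(1)[OF q'(1)]] by (simp add: norm_dominated_def)
    then show "volume_in ?G {x \<in> ?G. q x x \<le> 1} \<le> volume_in ?G S'"
      unfolding q'(2) volume_in_le_iff_gauss_le[OF G norm_dominatedD(1)[OF d] q'(1)]
      using extremalD(2)[OF ex] b(3) by simp
  next
    fix S assume S: "ellipsoid_in ?G S \<and> cball 0 1 \<inter> ?G \<subseteq> S \<and>
      (\<forall>S'. ellipsoid_in ?G S' \<and> cball 0 1 \<inter> ?G \<subseteq> S' \<longrightarrow> volume_in ?G S \<le> volume_in ?G S')"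
    then obtain p where p: "inner_product_on ?G p" "S = {x \<in> ?G. p x x \<le> 1}"
      by (auto simp: ellipsoid_in_def)
    have "extremal ?b p"
      unfolding extremal_def b(3)
    proof (intro conjI allI impI)
      show "norm_dominated ?G p"
        using S p ball_subset_ellipsoid_iff[OF G(1) inner_product_onD(1)[OF p(1)]] by (simp add: norm_dominated_def)
      fix q' assume q': "norm_dominated ?G q'"
      then have "ellipsoid_in ?G {x \<in> ?G. q' x x \<le> 1}" "cball 0 1 \<inter> ?G \<subseteq> {x \<in> ?G. q' x x \<le> 1}"
        using ball_subset_ellipsoid_iff[OF G(1) norm_dominatedD(2)[OF q']]
        by (auto simp: ellipsoid_in_def norm_dominated_def)
      then show "gauss ?b p \<le> gauss ?b q'"
        using S volume_in_le_iff_gauss_le[OF G p(1) norm_dominatedD(1)[OF q']] p(2) by blast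
    qed
    then have "p x x = q x x" if "x \<in> ?G" for x
      using extremal_unique[OF b(1,2) _ ex] that b(3) by simp
    then show "S = {x \<in> ?G. q x x \<le> 1}" using p(2) by auto
  qed
qed

section \<open>Extremal forms on direct sums\<close>

lemma linear_projection:
  fixes B B' :: "'a::real_vector set"
  assumes "independent (B \<union> B')" "B \<inter> B' = {}"
  obtains P where "linear P" "\<And>x. x \<in> span B \<Longrightarrow> P x = x" "\<And>y. y \<in> span B' \<Longrightarrow> P y = 0"
proof -
  obtain P where P: "linear P" "\<forall>x\<in>B \<union> B'. P x = (if x \<in> B then x else 0)"
    using linear_independent_extend[OF assms(1), of "\<lambda>x. if x \<in> B then x else 0"] by auto
  have "P x = id x" if "x \<in> span B" for x
    using P by (intro linear_eq_on[OF P(1) linear_id that]) auto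
  moreover have "P y = 0" if "y \<in> span B'" for y
  proof (rule linear_eq_on[OF P(1) _ that])
    show "linear (\<lambda>_ :: 'a. 0 :: 'a)" by (simp add: linear_iff)
  qed (use P assms(2) in auto)
  ultimately show ?thesis using that P(1) by simp
qed

text \<open>This is the source of competitors for the extremal form of a direct sum.\<close>

lemma direct_sum_form:
  assumes B: "finite B" "finite B'" "B \<inter> B' = {}" "independent (B \<union> B')"
    and a: "inner_product_on (span B) a" and b: "inner_product_on (span B') b"
  obtains h where "inner_product_on (span (B \<union> B')) h"
    and "\<And>x y. x \<in> span B \<Longrightarrow> y \<in> span B' \<Longrightarrow> h (x + y) (x + y) = a x x + b y y"
    and "gauss (B \<union> B') h = gauss B a * gauss B' b"
proof -
  obtain P where P: "linear P" "\<And>x. x \<in> span B \<Longrightarrow> P x = x" "\<And>y. y \<in> span B' \<Longrightarrow> P y = 0"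
    using linear_projection[OF B(4,3)] by blast
  define h where "h z w = a (P z) (P w) + b (z - P z) (w - P w)" for z w
  have dec: "\<exists>x\<in>span B. \<exists>y\<in>span B'. z = x + y" if "z \<in> span (B \<union> B')" for z
    using that by (auto simp: span_Un)
  have Pz: "P z \<in> span B" "z - P z \<in> span B'" if "z \<in> span (B \<union> B')" for z
    using dec[OF that] P by (auto simp: linear_add)
  note sa = inner_product_onD(1)[OF a] and sb = inner_product_onD(1)[OF b]
  have h_add: "h (x + y) (x + y) = a x x + b y y" if "x \<in> span B" "y \<in> span B'" for x y
    using P that by (simp add: h_def linear_add)
  have hs: "sym_bilinear_on (span (B \<union> B')) h"
  proof (rule sym_bilinear_onI)
    fix x y z assume S: "x \<in> span (B \<union> B')" "y \<in> span (B \<union> B')" "z \<in> span (B \<union> B')"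
    have *: "x + y - P (x + y) = (x - P x) + (y - P y)" using P(1) by (simp add: linear_add)
    show "h (x + y) z = h x z + h y z"
      unfolding h_def *
      using form_add[OF subspace_span sa, of "P x" "P y" "P z"] Pz S P(1)
        form_add[OF subspace_span sb, of "x - P x" "y - P y" "z - P z"]
      by (simp add: linear_add)
  next
    fix t x z assume S: "x \<in> span (B \<union> B')" "z \<in> span (B \<union> B')"
    have *: "t *\<^sub>R x - P (t *\<^sub>R x) = t *\<^sub>R (x - P x)"
      using P(1) by (simp add: linear_scale scaleR_diff_right)
    show "h (t *\<^sub>R x) z = t * h x z"
      unfolding h_def *
      using form_scale[OF subspace_span sa, of "P x" "P z"] Pz S P(1)
        form_scale[OF subspace_span sb, of "x - P x" "z - P z"]
      by (simp add: linear_scale distrib_left)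
  next
    fix x y assume S: "x \<in> span (B \<union> B')" "y \<in> span (B \<union> B')"
    show "h x y = h y x"
      using form_sym[OF subspace_span sa, of "P x" "P y"] form_sym[OF subspace_span sb, of "x - P x" "y - P y"]
        Pz S by (simp add: h_def)
  qed
  have "h z z > 0" if z: "z \<in> span (B \<union> B')" "z \<noteq> 0" for z
  proof -
    have nn: "a (P z) (P z) \<ge> 0" "b (z - P z) (z - P z) \<ge> 0"
      using inner_product_nonneg[OF subspace_span a] inner_product_nonneg[OF subspace_span b] Pz[OF z(1)] by auto
    show ?thesis
    proof (cases "P z = 0")
      case True
      then show ?thesis using inner_product_onD(2)[OF b Pz(2)[OF z(1)]] z(2) nn(1)
        by (simp add: h_def add_nonneg_pos)
    next
      case False
      then show ?thesis using inner_product_onD(2)[OF a Pz(1)[OF z(1)]] nn(2)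
        by (simp add: h_def add_pos_nonneg)
    qed
  qed
  then have hi: "inner_product_on (span (B \<union> B')) h" using hs by (intro inner_product_onI)
  have hB: "h x x = a x x" if "x \<in> span B" for x
    using h_add[OF that span_zero] form_zero[OF subspace_span sb span_zero] by simp
  have hB': "h y y = b y y" if "y \<in> span B'" for y
    using h_add[OF span_zero that] form_zero[OF subspace_span sa span_zero] by simp
  have "gauss (B \<union> B') h = gauss B h * gauss B' h"
    by (rule gauss_Un[OF B(1-3) hs]) (simp add: h_add hB hB')
  also have "\<dots> = gauss B a * gauss B' b"
    using gauss_cong[of B h a] gauss_cong[of B' h b] hB hB' by simp
  finally show ?thesis using that hi h_add by blast
qed

text \<open>Reflecting the second summand preserves dominated forms and the Gaussian integral, so by
  uniqueness it preserves the extremal form.\<close>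

lemma extremal_orthogonal:
  fixes B B' :: "'a::real_normed_vector set"
  assumes B: "finite B" "finite B'" "B \<inter> B' = {}" "independent (B \<union> B')"
    and iso: "\<And>x y. x \<in> span B \<Longrightarrow> y \<in> span B' \<Longrightarrow> norm (x - y) = norm (x + y)"
    and q: "extremal (B \<union> B') q"
    and x: "x \<in> span B" and y: "y \<in> span B'"
  shows "q (x + y) (x + y) = q x x + q y y"
proof -
  let ?S = "span (B \<union> B')"
  have fU: "finite (B \<union> B')" using B by simp
  obtain P where P: "linear P" "\<And>x. x \<in> span B \<Longrightarrow> P x = x" "\<And>y. y \<in> span B' \<Longrightarrow> P y = 0"
    using linear_projection[OF B(4,3)] by blast
  define R where "R z = 2 *\<^sub>R P z - z" for z
  have R: "R (x + y) = x - y" if "x \<in> span B" "y \<in> span B'" for x y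
    using P that by (simp add: R_def linear_add scaleR_2)
  have R_add: "R (z + w) = R z + R w" and R_scale: "R (t *\<^sub>R z) = t *\<^sub>R R z" for z w t
    using P(1) by (simp_all add: R_def linear_add linear_scale algebra_simps)
  have sub: "span B \<subseteq> ?S" "span B' \<subseteq> ?S" by (auto intro!: span_mono)
  have dec: "\<exists>x\<in>span B. \<exists>y\<in>span B'. z = x + y" if "z \<in> ?S" for z
    using that by (auto simp: span_Un)
  have RS: "R z \<in> ?S" if zS: "z \<in> ?S" for z
  proof -
    obtain x y where "x \<in> span B" "y \<in> span B'" "z = x + y" using dec[OF zS] by blast
    then show ?thesis using R sub by (auto intro!: span_diff)
  qed
  note d = norm_dominatedD[OF extremalD(1)[OF q]]
  define q' where "q' z w = q (R z) (R w)" for z w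
  have q's: "sym_bilinear_on ?S q'"
    unfolding q'_def
    by (intro sym_bilinear_onI)
      (simp_all add: R_add R_scale RS form_add[OF subspace_span d(2)] form_scale[OF subspace_span d(2)]
        form_sym[OF subspace_span d(2)])
  have "norm_dominated ?S q'"
    unfolding norm_dominated_def
  proof (intro conjI ballI inner_product_onI q's)
    fix z assume z: "z \<in> ?S"
    obtain x y where xy: "x \<in> span B" "y \<in> span B'" "z = x + y" using dec[OF z] by blast
    show "q' z z \<le> (norm z)\<^sup>2"
      using d(3)[OF RS[OF z]] R[OF xy(1,2)] iso[OF xy(1,2)] by (simp add: q'_def xy(3))
    assume "z \<noteq> 0"
    have "R (R z) = z"
      using xy(3) R[OF xy(1,2)] R[OF xy(1) span_neg[OF xy(2)]] by simp
    moreover have "R 0 = 0" using R_scale[of 0 0] by simp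
    ultimately have "R z \<noteq> 0" using \<open>z \<noteq> 0\<close> by metis
    then show "q' z z > 0" unfolding q'_def by (intro inner_product_onD(2)[OF d(1) RS[OF z]])
  qed
  moreover have "gauss (B \<union> B') q' = gauss (B \<union> B') q"
    by (rule gauss_reflect[OF B(1-3) d(2)]) (simp add: q'_def R)
  ultimately have "extremal (B \<union> B') q'" using extremalD(2)[OF q] by (simp add: extremal_def)
  moreover have xS: "x \<in> ?S" and yS: "y \<in> ?S" using x y sub by auto
  ultimately have "q (x - y) (x - y) = q (x + y) (x + y)"
    using extremal_unique[OF fU B(4) _ q, of q' "x + y"] R[OF x y] by (simp add: q'_def span_add)
  then show ?thesis
    using form_square_add[OF subspace_span d(2) xS yS] form_square_diff[OF subspace_span d(2) xS yS] by simp
qed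

lemma gauss_extremal_split:
  fixes B B' :: "'a::real_normed_vector set"
  assumes B: "finite B" "finite B'" "B \<inter> B' = {}" "independent (B \<union> B')"
    and iso: "\<And>x y. x \<in> span B \<Longrightarrow> y \<in> span B' \<Longrightarrow> norm (x - y) = norm (x + y)"
    and q: "extremal (B \<union> B') q"
  shows "gauss (B \<union> B') q = gauss B q * gauss B' q"
  using extremal_orthogonal[OF B iso q] norm_dominatedD(2)[OF extremalD(1)[OF q]]
  by (intro gauss_Un B) auto

text \<open>The Pythagorean inequality keeps the extremal form dominated when its first component is replaced by
  any dominated form. As the Gaussian integral is multiplicative, the component that was replaced is
  then itself extremal.\<close>

lemma extremal_restrict:
  fixes B B' :: "'a::real_normed_vector set"
  assumes B: "finite B" "finite B'" "B \<inter> B' = {}" "independent (B \<union> B')"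
    and iso: "\<And>x y. x \<in> span B \<Longrightarrow> y \<in> span B' \<Longrightarrow> norm (x - y) = norm (x + y)"
    and pyth: "\<And>x y. x \<in> span B \<Longrightarrow> y \<in> span B' \<Longrightarrow> (norm x)\<^sup>2 + (norm y)\<^sup>2 \<le> (norm (x + y))\<^sup>2"
    and q: "extremal (B \<union> B') q"
  shows "extremal B q"
  unfolding extremal_def
proof (intro conjI allI impI)
  let ?S = "span (B \<union> B')"
  have sub: "span B \<subseteq> ?S" "span B' \<subseteq> ?S" by (auto intro!: span_mono)
  note d = norm_dominatedD[OF extremalD(1)[OF q]]
  note qB = inner_product_on_mono[OF d(1) sub(1)] and qB' = inner_product_on_mono[OF d(1) sub(2)]
  show "norm_dominated (span B) q" using qB d(3) sub(1) by (auto simp: norm_dominated_def)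
  fix q' assume q': "norm_dominated (span B) q'"
  obtain h where h: "inner_product_on ?S h"
    "\<And>x y. x \<in> span B \<Longrightarrow> y \<in> span B' \<Longrightarrow> h (x + y) (x + y) = q' x x + q y y"
    "gauss (B \<union> B') h = gauss B q' * gauss B' q"
    using direct_sum_form[OF B norm_dominatedD(1)[OF q'] qB'] by blast
  have "h z z \<le> (norm z)\<^sup>2" if zS: "z \<in> ?S" for z
  proof -
    obtain x y where xy: "x \<in> span B" "y \<in> span B'" "z = x + y"
      using zS by (auto simp: span_Un)
    have "q' x x + q y y \<le> (norm x)\<^sup>2 + (norm y)\<^sup>2"
      using norm_dominatedD(3)[OF q' xy(1)] d(3)[of y] xy(2) sub(2) by (intro add_mono) auto
    then show ?thesis using h(2)[OF xy(1,2)] pyth[OF xy(1,2)] xy(3) by simp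
  qed
  then have "gauss (B \<union> B') q \<le> gauss (B \<union> B') h"
    by (intro extremalD(2)[OF q]) (simp add: norm_dominated_def h(1))
  then have "gauss B' q * gauss B q \<le> gauss B' q * gauss B q'"
    using gauss_extremal_split[OF B iso q] h(3) by (simp add: mult.commute)
  moreover have "independent B'" using B(4) by (rule independent_mono) auto
  ultimately show "gauss B q \<le> gauss B q'"
    using gauss_pos[OF B(2) inner_product_onD(1)[OF qB']] gauss_finite[OF B(2) _ qB']
    by (simp add: ennreal_mult_le_mult_iff)
qed

section \<open>The p-sum\<close>

lemma p_sum_exponent_cases:
  assumes "1 \<le> (p :: ereal)"
  obtains "p = \<infinity>" | r where "p = ereal r" "1 \<le> r"
  using assms by (cases p) auto

lemma exponent_ge_1: "2 < (p :: ereal) \<Longrightarrow> 1 \<le> p"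
  by (cases p) auto

lemma p_sumD:
  assumes "is_p_sum p F E"
  shows "subspace F" "subspace E" "F \<inter> E = {0}" "\<And>z. \<exists>x\<in>F. \<exists>y\<in>E. z = x + y"
  using assms by (auto simp: is_p_sum_def)

lemma p_sum_norm:
  assumes "is_p_sum p F E" "x \<in> F" "y \<in> E"
  shows "p = \<infinity> \<Longrightarrow> norm (x + y) = max (norm x) (norm y)"
    and "p = ereal r \<Longrightarrow> norm (x + y) = (norm x powr r + norm y powr r) powr (1 / r)"
  using assms by (auto simp: is_p_sum_def)

lemma p_sum_norm_diff:
  assumes "is_p_sum p F E" "x \<in> F" "y \<in> E"
  shows "norm (x - y) = norm (x + y)"
proof -
  have "- y \<in> E" using p_sumD(2)[OF assms(1)] assms(3) by (simp add: subspace_neg)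
  then have "norm (x + - y) = (if p = \<infinity> then max (norm x) (norm (- y))
      else (norm x powr real_of_ereal p + norm (- y) powr real_of_ereal p) powr (1 / real_of_ereal p))"
    using assms unfolding is_p_sum_def by blast
  also have "\<dots> = norm (x + y)" using assms by (simp add: is_p_sum_def)
  finally show ?thesis by simp
qed

lemma p_sum_norm_ge:
  assumes p: "1 \<le> p" "is_p_sum p F E" "x \<in> F" "y \<in> E"
  shows "norm x \<le> norm (x + y)" "norm y \<le> norm (x + y)"
proof -
  have "norm x \<le> norm (x + y) \<and> norm y \<le> norm (x + y)"
    using p(1)
  proof (cases rule: p_sum_exponent_cases)
    case 1
    then show ?thesis using p_sum_norm(1)[OF p(2-4)] by simp
  next
    case (2 r)
    have root: "a \<le> (a powr r + b powr r) powr (1 / r)" if "a \<ge> 0" for a b :: real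
    proof -
      have "a = (a powr r) powr (1 / r)" using 2 that by (simp add: powr_powr)
      also have "\<dots> \<le> (a powr r + b powr r) powr (1 / r)"
        using 2 by (intro powr_mono2) auto
      finally show ?thesis .
    qed
    show ?thesis
      using root[of "norm x" "norm y"] root[of "norm y" "norm x"] p_sum_norm(2)[OF p(2-4) 2(1)]
      by (simp add: add.commute)
  qed
  then show "norm x \<le> norm (x + y)" "norm y \<le> norm (x + y)" by auto
qed

text \<open>Both \<open>a\<close> and \<open>b\<close> satisfy \<open>c powr s = c * c powr (s - 1) \<le> c * (a + b) powr (s - 1)\<close>.\<close>

lemma powr_superadditive:
  fixes a b s :: real
  assumes "a \<ge> 0" "b \<ge> 0" "s \<ge> 1"
  shows "a powr s + b powr s \<le> (a + b) powr s"
proof -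
  have step: "c powr s \<le> c * (a + b) powr (s - 1)" if "0 \<le> c" "c \<le> a + b" for c
  proof (cases "c = 0")
    case False
    then have "c powr s = c * c powr (s - 1)" using that by (simp add: powr_mult_base)
    also have "\<dots> \<le> c * (a + b) powr (s - 1)"
      using that assms by (intro mult_left_mono powr_mono2) auto
    finally show ?thesis .
  qed simp
  have "a powr s + b powr s \<le> a * (a + b) powr (s - 1) + b * (a + b) powr (s - 1)"
    using assms by (intro add_mono step) auto
  also have "\<dots> = (a + b) powr s"
    using assms by (cases "a + b = 0") (simp_all add: powr_mult_base flip: distrib_right)
  finally show ?thesis .
qed

lemma p_sum_norm_Pythagoras:
  assumes p: "1 \<le> p" "p \<le> 2" "is_p_sum p F E" "x \<in> F" "y \<in> E"
  shows "(norm x)\<^sup>2 + (norm y)\<^sup>2 \<le> (norm (x + y))\<^sup>2"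
  using p(1)
proof (cases rule: p_sum_exponent_cases)
  case 1
  then show ?thesis using p(2) by simp
next
  case (2 r)
  then have r: "r \<le> 2" using p(2) by simp
  have sq: "(a powr (1 / r))\<^sup>2 = a powr (2 / r)" for a :: real
    by (simp add: power2_eq_square flip: powr_add)
  have "(norm z powr r) powr (2 / r) = (norm z)\<^sup>2" for z :: 'a
    using 2(2) by (cases "z = 0") (simp_all add: powr_powr powr_numeral)
  then show ?thesis
    using powr_superadditive[of "norm x powr r" "norm y powr r" "2 / r"] r 2(2)
      p_sum_norm(2)[OF p(3-5) 2(1)] by (simp add: sq)
qed

lemma component_eq:
  assumes p: "is_p_sum p F E" and xy: "x \<in> F" "y \<in> E"
  shows "component F E (x + y) = x"
  unfolding component_def
proof (rule the_equality)
  show "x \<in> F \<and> (\<exists>w\<in>E. x + y = x + w)" using xy by blast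
  fix x' assume "x' \<in> F \<and> (\<exists>w\<in>E. x + y = x' + w)"
  then obtain w where w: "x' \<in> F" "w \<in> E" "x + y = x' + w" by blast
  have "x' - x = y - w" using w(3) by (simp add: algebra_simps)
  moreover have "x' - x \<in> F" "y - w \<in> E"
    using p_sumD(1,2)[OF p] w xy by (auto intro: subspace_diff)
  ultimately have "x' - x \<in> F \<inter> E" by simp
  then show "x' = x" using p_sumD(3)[OF p] by simp
qed

lemma pair_functional_zero_apply:
  assumes p: "1 \<le> p" "is_p_sum p F E" and f: "f \<in> dual_of F" and xy: "x \<in> F" "y \<in> E"
  shows "blinfun_apply (pair_functional F E f (\<lambda>_. 0)) (x + y) = f x"
proof -
  let ?g = "\<lambda>z. f (component F E z) + 0"
  note comp = component_eq[OF p(2)]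
  obtain C where f_lin: "linear_functional_on F f" and C: "\<And>x. x \<in> F \<Longrightarrow> \<bar>f x\<bar> \<le> C * norm x"
    using f by (auto simp: dual_of_def)
  have "bounded_linear ?g"
  proof (rule bounded_linear_intro)
    fix z w :: 'a
    obtain x y where z: "x \<in> F" "y \<in> E" "z = x + y" using p_sumD(4)[OF p(2)] by blast
    obtain x' y' where w: "x' \<in> F" "y' \<in> E" "w = x' + y'" using p_sumD(4)[OF p(2)] by blast
    have "z + w = (x + x') + (y + y')" "x + x' \<in> F" "y + y' \<in> E"
      using z w p_sumD(1,2)[OF p(2)] by (auto intro: subspace_add)
    then have "component F E (z + w) = x + x'" by (metis comp)
    then show "?g (z + w) = ?g z + ?g w"
      using comp z w f_lin by (simp add: linear_functional_on_def)
  next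
    fix t :: real and z :: 'a
    obtain x y where z: "x \<in> F" "y \<in> E" "z = x + y" using p_sumD(4)[OF p(2)] by blast
    have "t *\<^sub>R z = t *\<^sub>R x + t *\<^sub>R y" "t *\<^sub>R x \<in> F" "t *\<^sub>R y \<in> E"
      using z p_sumD(1,2)[OF p(2)] by (auto intro: subspace_scale simp: scaleR_add_right)
    then have "component F E (t *\<^sub>R z) = t *\<^sub>R x" by (metis comp)
    then show "?g (t *\<^sub>R z) = t *\<^sub>R ?g z"
      using comp z f_lin by (simp add: linear_functional_on_def)
  next
    fix z :: 'a
    obtain x y where z: "x \<in> F" "y \<in> E" "z = x + y" using p_sumD(4)[OF p(2)] by blast
    have "\<bar>f x\<bar> \<le> C * norm x" by (rule C[OF z(1)])
    also have "\<dots> \<le> \<bar>C\<bar> * norm (x + y)"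
      using p_sum_norm_ge(1)[OF p z(1,2)] by (intro mult_mono) auto
    finally show "norm (?g z) \<le> norm z * \<bar>C\<bar>" using comp z by (simp add: mult.commute)
  qed
  then show ?thesis
    unfolding pair_functional_def by (subst bounded_linear_Blinfun_apply) (simp_all add: comp[OF xy])
qed

lemma independent_Un_direct:
  assumes FE: "subspace F" "subspace E" "F \<inter> E = {0}"
    and B: "finite B" "independent B" "B \<subseteq> F" and B': "finite B'" "independent B'" "B' \<subseteq> E"
  shows "B \<inter> B' = {}" "independent (B \<union> B')"
proof -
  have "B \<inter> B' \<subseteq> {0}" using B(3) B'(3) FE(3) by auto
  moreover have "0 \<notin> B" using B(2) dependent_zero by blast
  ultimately show dis: "B \<inter> B' = {}" by auto
  show "independent (B \<union> B')"
  proof (rule independent_if_scalars_zero)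
    show "finite (B \<union> B')" using B B' by simp
    fix c x assume "lincomb (B \<union> B') c = 0" and x: "x \<in> B \<union> B'"
    then have sum0: "lincomb B c + lincomb B' c = 0"
      using B(1) B'(1) dis by (simp add: sum.union_disjoint)
    have in_F: "lincomb B c \<in> F" using B(3) FE(1) by (intro subspace_sum subspace_scale) auto
    have in_E: "lincomb B' c \<in> E" using B'(3) FE(2) by (intro subspace_sum subspace_scale) auto
    have "lincomb B c = - lincomb B' c" using sum0 by (simp add: eq_neg_iff_add_eq_0)
    then have "lincomb B c \<in> F \<inter> E" using in_F in_E FE(2) by (simp add: subspace_neg)
    then have "lincomb B c = 0" "lincomb B' c = 0" using sum0 FE(3) by auto
    then show "c x = 0"
      using x independentD[OF B(2,1) order_refl, of c x] independentD[OF B'(2,1) order_refl, of c x] by auto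
  qed
qed

lemma finite_dim_subspace_basis:
  assumes V: "subspace V" and A: "finite A" "V \<subseteq> span A"
  obtains B where "finite B" "independent B" "span B = V"
proof -
  obtain B where B: "B \<subseteq> V" "independent B" "V \<subseteq> span B" by (rule maximal_independent_subset)
  have "finite B" using independent_span_bound[OF A(1) B(2)] B(1) A(2) by auto
  moreover have "span B = V" using B V by (intro subset_antisym span_minimal)
  ultimately show ?thesis using that B(2) by blast
qed

section \<open>Exponents at most two\<close>

text \<open>The extremal form of \<open>G\<close> restricts to that of \<open>F\<close> and makes \<open>F\<close> orthogonal to \<open>G \<inter> E\<close>. Hence the
  minimum volume ellipsoid of \<open>G\<close> projects onto that of \<open>F\<close>, and the functional only sees this
  projection.\<close>

lemma eta_p_sum_eq:
  fixes F E G :: "'a::real_normed_vector set"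
  assumes p: "1 \<le> p" "p \<le> 2" "is_p_sum p F E" and f: "f \<in> dual_of F"
    and F: "finite_dim F" and G: "subspace G" "finite_dim G" "F \<subseteq> G"
  defines "g \<equiv> pair_functional F E f (\<lambda>_. 0)"
  shows "eta g G = eta g F"
proof -
  note ps = p_sumD[OF p(3)]
  obtain A where A: "finite A" "span A = G" using G(2) by (auto simp: finite_dim_def)
  obtain B where B: "finite B" "independent B" "span B = F"
    using finite_dim_subspace_basis[OF ps(1) A(1)] A(2) G(3) by blast
  have "subspace (G \<inter> E)" using G(1) ps(2) by (rule subspace_inter)
  then obtain B' where B': "finite B'" "independent B'" "span B' = G \<inter> E"
    using finite_dim_subspace_basis[OF _ A(1), of "G \<inter> E"] A(2) by blast
  have BF: "B \<subseteq> F" and BE: "B' \<subseteq> E"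
    using span_superset[of B] span_superset[of B'] B(3) B'(3) by auto
  have U: "B \<inter> B' = {}" "independent (B \<union> B')"
    using independent_Un_direct[OF ps(1-3) B(1,2) BF B'(1,2) BE] by auto
  have fU: "finite (B \<union> B')" using B B' by simp
  have spanU: "span (B \<union> B') = G"
  proof
    show "span (B \<union> B') \<subseteq> G"
      using B(3) B'(3) span_superset[of B] span_superset[of B'] G by (intro span_minimal) auto
    show "G \<subseteq> span (B \<union> B')"
    proof
      fix z assume z: "z \<in> G"
      obtain x y where xy: "x \<in> F" "y \<in> E" "z = x + y" using ps(4) by blast
      have "z - x \<in> G" using z xy G by (intro subspace_diff) auto
      then have "y \<in> G \<inter> E" using xy by simp
      then show "z \<in> span (B \<union> B')" using xy B(3) B'(3) by (auto simp: span_Un)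
    qed
  qed
  have iso: "norm (x - y) = norm (x + y)" if "x \<in> span B" "y \<in> span B'" for x y
    using that B(3) B'(3) p_sum_norm_diff[OF p(3)] by auto
  have pyth: "(norm x)\<^sup>2 + (norm y)\<^sup>2 \<le> (norm (x + y))\<^sup>2" if "x \<in> span B" "y \<in> span B'" for x y
    using that B(3) B'(3) p_sum_norm_Pythagoras[OF p] by auto
  obtain q where q: "extremal (B \<union> B') q" using extremal_exists[OF fU U(2)] by blast
  have qB: "extremal B q" by (rule extremal_restrict[OF B(1) B'(1) U iso pyth q])
  have eG: "min_ellipsoid G = {x \<in> G. q x x \<le> 1}" using min_ellipsoid_eq[OF fU U(2) q] spanU by simp
  have eF: "min_ellipsoid F = {x \<in> F. q x x \<le> 1}" using min_ellipsoid_eq[OF B(1,2) qB] B(3) by simp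
  have orth: "q (x + y) (x + y) = q x x + q y y" if "x \<in> F" "y \<in> G \<inter> E" for x y
    using extremal_orthogonal[OF B(1) B'(1) U iso q] that B(3) B'(3) by simp
  have gx: "blinfun_apply g (x + y) = f x" if "x \<in> F" "y \<in> E" for x y
    unfolding g_def by (rule pair_functional_zero_apply[OF p(1,3) f that])
  have "(\<lambda>y. \<bar>blinfun_apply g y\<bar>) ` min_ellipsoid G = (\<lambda>y. \<bar>blinfun_apply g y\<bar>) ` min_ellipsoid F"
  proof (intro subset_antisym image_subsetI)
    fix z assume z: "z \<in> min_ellipsoid G"
    obtain x y where xy: "x \<in> F" "y \<in> E" "z = x + y" using ps(4) by blast
    have "z - x \<in> G" using z xy G unfolding eG by (intro subspace_diff) auto
    then have y: "y \<in> G \<inter> E" using xy by simp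
    then have "q y y \<ge> 0"
      using inner_product_nonneg[OF subspace_span norm_dominatedD(1)[OF extremalD(1)[OF q]]] spanU by simp
    then have "x \<in> min_ellipsoid F" using z orth[OF xy(1) y] xy unfolding eG eF by simp
    moreover have "blinfun_apply g z = blinfun_apply g x"
      using gx[OF xy(1,2)] gx[OF xy(1) subspace_0[OF ps(2)]] xy(3) by simp
    ultimately show "\<bar>blinfun_apply g z\<bar> \<in> (\<lambda>y. \<bar>blinfun_apply g y\<bar>) ` min_ellipsoid F" by auto
  next
    fix x assume "x \<in> min_ellipsoid F"
    then show "\<bar>blinfun_apply g x\<bar> \<in> (\<lambda>y. \<bar>blinfun_apply g y\<bar>) ` min_ellipsoid G"
      using G(3) unfolding eG eF by auto
  qed
  then show ?thesis by (simp add: eta_def)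
qed

section \<open>Exponents greater than two\<close>

lemma isometric_to_ell2_inner_product:
  assumes E: "subspace E" and "isometric_to_ell2 E"
  obtains ip where "sym_bilinear_on E ip" "\<And>y. y \<in> E \<Longrightarrow> ip y y = (norm y)\<^sup>2"
proof -
  obtain T where T: "\<And>n. linear_functional_on E (\<lambda>x. T x n)" "T ` E = ell2"
    "\<And>x. x \<in> E \<Longrightarrow> ell2_norm (T x) = norm x"
    using assms(2) by (auto simp: isometric_to_ell2_def)
  define ip where "ip x y = (\<Sum>n. T x n * T y n)" for x y
  have sq: "summable (\<lambda>n. (T x n)\<^sup>2)" if "x \<in> E" for x
    using T(2) that by (auto simp: ell2_def)
  have sm: "summable (\<lambda>n. T x n * T y n)" if "x \<in> E" "y \<in> E" for x y
  proof (rule summable_comparison_test')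
    show "summable (\<lambda>n. (T x n)\<^sup>2 + (T y n)\<^sup>2)" by (intro summable_add sq that)
    show "norm (T x n * T y n) \<le> (T x n)\<^sup>2 + (T y n)\<^sup>2" if "n \<ge> 0" for n
    proof -
      have "2 * (\<bar>T x n\<bar> * \<bar>T y n\<bar>) \<le> (T x n)\<^sup>2 + (T y n)\<^sup>2"
        using sum_squares_bound[of "\<bar>T x n\<bar>" "\<bar>T y n\<bar>"] by (simp add: mult.assoc)
      moreover have "\<bar>T x n\<bar> * \<bar>T y n\<bar> \<ge> 0" by simp
      ultimately show ?thesis unfolding real_norm_def abs_mult by linarith
    qed
  qed
  have "sym_bilinear_on E ip"
  proof (rule sym_bilinear_onI)
    fix x y z assume xyz: "x \<in> E" "y \<in> E" "z \<in> E"
    have "T (x + y) n * T z n = T x n * T z n + T y n * T z n" for n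
      using T(1) xyz by (simp add: linear_functional_on_def distrib_right)
    then show "ip (x + y) z = ip x z + ip y z"
      by (simp add: ip_def suminf_add[OF sm sm] xyz)
  next
    fix t x z assume xz: "x \<in> E" "z \<in> E"
    have *: "T (t *\<^sub>R x) n * T z n = t * (T x n * T z n)" for n
      using T(1) xz by (simp add: linear_functional_on_def)
    show "ip (t *\<^sub>R x) z = t * ip x z"
      unfolding ip_def * by (rule suminf_mult[OF sm[OF xz]])
  qed (simp add: ip_def mult.commute)
  moreover have "ip y y = (norm y)\<^sup>2" if "y \<in> E" for y
  proof -
    have "(\<Sum>n. (T y n)\<^sup>2) \<ge> 0" using sq[OF that] by (intro suminf_nonneg) auto
    then show ?thesis unfolding T(3)[OF that, symmetric] ell2_norm_def
      by (simp add: ip_def power2_eq_square[symmetric])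
  qed
  ultimately show ?thesis by (rule that)
qed

lemma isometric_to_ell2_independent:
  assumes E: "subspace E" and "isometric_to_ell2 E"
  obtains W where "W \<subseteq> E" "finite W" "independent W" "card W = N"
proof -
  obtain T where T: "\<And>n. linear_functional_on E (\<lambda>x. T x n)" "T ` E = ell2"
    using assms(2) by (auto simp: isometric_to_ell2_def)
  have "\<exists>w\<in>E. \<forall>n. T w n = of_bool (n = i)" for i
  proof -
    have "summable (\<lambda>n. (of_bool (n = i) :: real)\<^sup>2)"
      by (rule summable_finite[of "{i}"]) auto
    then have "(\<lambda>n. of_bool (n = i)) \<in> ell2" by (simp add: ell2_def)
    then show ?thesis unfolding T(2)[symmetric] by (metis imageE)
  qed
  then obtain w where w: "\<And>i. w i \<in> E" "\<And>i n. T (w i) n = of_bool (n = i)" by metis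
  have inj: "inj w"
  proof (rule injI)
    fix i j assume "w i = w j"
    then have "of_bool (i = j) = (1 :: real)" using w(2)[of i i] w(2)[of j i] by simp
    then show "i = j" by simp
  qed
  let ?W = "w ` {..<N}"
  have "independent ?W"
  proof (rule independent_if_scalars_zero)
    fix c x assume "lincomb ?W c = 0" and x: "x \<in> ?W"
    then have s0: "(\<Sum>i<N. c (w i) *\<^sub>R w i) = 0"
      using inj by (subst (asm) sum.reindex) (auto intro: inj_on_subset)
    obtain j where j: "j < N" "x = w j" using x by auto
    have "T 0 j = 0" using linear_functional_on_sum[OF E T(1)[of j], of "{}"] by simp
    moreover have "T (\<Sum>i<N. c (w i) *\<^sub>R w i) j = (\<Sum>i<N. c (w i) * T (w i) j)"
      using linear_functional_on_sum[OF E T(1)[of j], of "{..<N}" w "\<lambda>i. c (w i)"] w(1) by simp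
    moreover have "(\<Sum>i<N. c (w i) * T (w i) j) = c (w j)"
      using j by (simp add: w(2) if_distrib of_bool_def cong: if_cong)
    ultimately show "c x = 0" using s0 j by simp
  qed simp
  moreover have "card ?W = N" using inj by (simp add: card_image inj_on_subset)
  ultimately show ?thesis using that[of ?W] w(1) by auto
qed

text \<open>For finite \<open>p\<close> the squared norm is \<open>(1 + s powr p) powr (2 / p) \<le> 1 + s powr p\<close>, and for small \<open>s\<close> the
  term \<open>s powr p\<close> is less than \<open>e * s\<^sup>2\<close> because \<open>p > 2\<close>. For \<open>p = \<infinity>\<close> the squared
  norm is still \<open>1\<close> at \<open>s = 1\<close>.\<close>

lemma p_sum_norm_flat:
  assumes p: "2 < p" "is_p_sum p F E" and e: "e > 0"
  obtains s \<gamma> where "s > 0" "0 < \<gamma>" "\<gamma> < 1"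
    "\<And>x y. x \<in> F \<Longrightarrow> y \<in> E \<Longrightarrow> norm x = s \<Longrightarrow> norm y = 1 \<Longrightarrow> (norm (x + y))\<^sup>2 \<le> \<gamma> + e * s\<^sup>2"
proof -
  have "1 \<le> p" using p(1) by (rule exponent_ge_1)
  then show ?thesis
  proof (cases rule: p_sum_exponent_cases)
    case 1
    show ?thesis
    proof (rule that[of 1 "max (1 / 2) (1 - e)"])
      fix x y assume "x \<in> F" "y \<in> E" "norm x = 1" "norm y = 1"
      then show "(norm (x + y))\<^sup>2 \<le> max (1 / 2) (1 - e) + e * 1\<^sup>2"
        using p_sum_norm(1)[OF p(2) _ _ 1] by simp
    qed (use e in auto)
  next
    case (2 r)
    have r: "r > 2" using p(1) 2(1) by simp
    \<comment> \<open>With this choice \<open>s powr r\<close> is half of \<open>e * s\<^sup>2\<close>.\<close>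
    define s where "s = (e / 2) powr (1 / (r - 2))"
    have s: "s > 0" using e by (simp add: s_def)
    have "s powr (r - 2) = e / 2" using r e by (simp add: s_def powr_powr)
    moreover have "s powr r = s powr 2 * s powr (r - 2)" by (simp flip: powr_add)
    ultimately have sr: "s powr r = s\<^sup>2 * (e / 2)" using s by (simp add: powr_numeral)
    show ?thesis
    proof (rule that[of s "max (1 / 2) (1 - s\<^sup>2 * (e / 2))"])
      fix x y assume xy: "x \<in> F" "y \<in> E" "norm x = s" "norm y = 1"
      have "norm (x + y) = (s powr r + 1) powr (1 / r)"
        using p_sum_norm(2)[OF p(2) xy(1,2) 2(1)] xy(3,4) by simp
      then have "(norm (x + y))\<^sup>2 = (s powr r + 1) powr (2 / r)"
        by (simp add: power2_eq_square flip: powr_add)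
      also have "\<dots> \<le> (s powr r + 1) powr 1"
        using r by (intro powr_mono) auto
      also have "\<dots> = 1 - s\<^sup>2 * (e / 2) + e * s\<^sup>2" using sr s e by (simp add: add_pos_pos)
      also have "\<dots> \<le> max (1 / 2) (1 - s\<^sup>2 * (e / 2)) + e * s\<^sup>2"
        by (intro add_right_mono max.cobounded2)
      finally show "(norm (x + y))\<^sup>2 \<le> max (1 / 2) (1 - s\<^sup>2 * (e / 2)) + e * s\<^sup>2" .
    qed (use s e in auto)
  qed
qed

text \<open>If the extremal form were at least \<open>\<epsilon>\<close> at \<open>v\<close>, it would be at most \<open>\<gamma> < 1\<close> times the squared norm
  on the second summand. Spending a fraction of the form on the first summand allows the full
  multiple \<open>\<mu> > \<gamma>\<close> of the squared norm there: this loses a factor depending on the first summand and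
  gains one that is exponential in the dimension of the second.\<close>

lemma extremal_small_at:
  fixes F E :: "'a::real_normed_vector set"
  assumes p: "2 < p" "is_p_sum p F E"
    and ip: "sym_bilinear_on E ip" "\<And>y. y \<in> E \<Longrightarrow> ip y y = (norm y)\<^sup>2"
    and B: "finite B" "independent B" "B \<subseteq> F" and v: "v \<in> span B" "v \<noteq> 0" and eps: "\<epsilon> > 0"
  obtains N where "\<And>B' q. finite B' \<Longrightarrow> independent B' \<Longrightarrow> B' \<subseteq> E \<Longrightarrow> N \<le> card B' \<Longrightarrow>
    extremal (B \<union> B') q \<Longrightarrow> q v v < \<epsilon>"
proof -
  note ps = p_sumD[OF p(2)]
  have p1: "1 \<le> p" using p(1) by (rule exponent_ge_1)
  define e where "e = \<epsilon> / (norm v)\<^sup>2"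
  have e: "e > 0" using eps v(2) by (simp add: e_def)
  obtain s \<gamma> where s: "s > 0" and gam: "0 < \<gamma>" "\<gamma> < 1"
    and flat: "\<And>x y. x \<in> F \<Longrightarrow> y \<in> E \<Longrightarrow> norm x = s \<Longrightarrow> norm y = 1 \<Longrightarrow> (norm (x + y))\<^sup>2 \<le> \<gamma> + e * s\<^sup>2"
    using p_sum_norm_flat[OF p e] by blast
  define \<mu> \<theta> where "\<mu> = (1 + \<gamma>) / 2" and "\<theta> = 1 - \<mu>"
  have mu: "\<gamma> < \<mu>" "0 < \<mu>" "0 < \<theta>" "\<theta> + \<mu> = 1" using gam by (auto simp: \<mu>_def \<theta>_def)
  have ratio: "1 < sqrt \<mu> / sqrt \<gamma>" using mu gam by simp
  then obtain N where N: "1 / sqrt \<theta> ^ card B < (sqrt \<mu> / sqrt \<gamma>) ^ N"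
    using real_arch_pow by blast
  have "q v v < \<epsilon>" if B': "finite B'" "independent B'" "B' \<subseteq> E" "N \<le> card B'"
    and q: "extremal (B \<union> B') q" for B' q
  proof (rule ccontr)
    assume "\<not> q v v < \<epsilon>"
    then have qv: "\<epsilon> \<le> q v v" by simp
    let ?S = "span (B \<union> B')"
    have U: "B \<inter> B' = {}" "independent (B \<union> B')"
      using independent_Un_direct[OF ps(1-3) B B'(1-3)] by auto
    have spF: "span B \<subseteq> F" and spE: "span B' \<subseteq> E"
      by (rule span_minimal[OF B(3) ps(1)], rule span_minimal[OF B'(3) ps(2)])
    have sub: "span B \<subseteq> ?S" "span B' \<subseteq> ?S" by (auto intro!: span_mono)
    have iso: "norm (x - y) = norm (x + y)" if "x \<in> span B" "y \<in> span B'" for x y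
      using that spF spE p_sum_norm_diff[OF p(2)] by auto
    note d = norm_dominatedD[OF extremalD(1)[OF q]]
    note qB = inner_product_on_mono[OF d(1) sub(1)] and qB' = inner_product_on_mono[OF d(1) sub(2)]
    have ipB': "inner_product_on (span B') ip"
      using ip spE by (intro inner_product_onI sym_bilinear_on_mono[OF ip(1)]) auto
    \<comment> \<open>The multiple of \<open>v\<close> of norm \<open>s\<close> uses up at least \<open>e * s\<^sup>2\<close> of the bound on \<open>q\<close>.\<close>
    have unit: "q y y \<le> \<gamma>" if y: "y \<in> span B'" "norm y = 1" for y
    proof -
      let ?u = "(s / norm v) *\<^sub>R v"
      have u: "?u \<in> span B" "norm ?u = s" using v s by (auto intro: span_scale)
      have "q ?u ?u = (s / norm v)\<^sup>2 * q v v"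
        using form_square_scale[OF subspace_span d(2)] v(1) sub(1) by blast
      also have "\<dots> \<ge> (s / norm v)\<^sup>2 * \<epsilon>" using qv by (intro mult_left_mono) auto
      finally have "e * s\<^sup>2 \<le> q ?u ?u" by (simp add: e_def power_divide mult.commute)
      moreover have "q ?u ?u + q y y \<le> (norm (?u + y))\<^sup>2"
        using extremal_orthogonal[OF B(1) B'(1) U iso q u(1) y(1)] d(3)[of "?u + y"] u(1) y(1) sub
        by (auto simp: span_add subset_iff)
      moreover have "(norm (?u + y))\<^sup>2 \<le> \<gamma> + e * s\<^sup>2"
        using u y spF spE by (intro flat) auto
      ultimately show ?thesis by linarith
    qed
    have qE: "q y y \<le> \<gamma> * ip y y" if y: "y \<in> span B'" for y
    proof (cases "y = 0")
      case True
      then show ?thesis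
        using form_zero[OF subspace_span d(2) span_zero] form_zero[OF ps(2) ip(1) subspace_0[OF ps(2)]] by simp
    next
      case False
      have "q ((1 / norm y) *\<^sub>R y) ((1 / norm y) *\<^sub>R y) \<le> \<gamma>"
        using y False by (intro unit) (auto intro: span_scale)
      then have "(1 / norm y)\<^sup>2 * q y y \<le> \<gamma>"
        using form_square_scale[OF subspace_span inner_product_onD(1)[OF qB'] y, of "1 / norm y"] by simp
      then show ?thesis using False ip(2)[of y] y spE by (auto simp: power_divide field_simps)
    qed
    have a: "inner_product_on (span B) (\<lambda>x y. \<theta> * q x y)"
      using qB mu(3) by (auto simp: inner_product_on_def linear_functional_on_def algebra_simps)
    have b: "inner_product_on (span B') (\<lambda>x y. \<mu> * ip x y)"
      using ipB' mu(2) by (auto simp: inner_product_on_def linear_functional_on_def algebra_simps)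
    obtain h where h: "inner_product_on ?S h"
      "\<And>x y. x \<in> span B \<Longrightarrow> y \<in> span B' \<Longrightarrow> h (x + y) (x + y) = \<theta> * q x x + \<mu> * ip y y"
      "gauss (B \<union> B') h = gauss B (\<lambda>x y. \<theta> * q x y) * gauss B' (\<lambda>x y. \<mu> * ip x y)"
      using direct_sum_form[OF B(1) B'(1) U a b] by blast
    have "h z z \<le> (norm z)\<^sup>2" if zS: "z \<in> ?S" for z
    proof -
      obtain x y where xy: "x \<in> span B" "y \<in> span B'" "z = x + y"
        using zS by (auto simp: span_Un)
      then have FE: "x \<in> F" "y \<in> E" using spF spE by auto
      have "q x x \<le> (norm x)\<^sup>2" using d(3) xy(1) sub(1) by blast
      also have "\<dots> \<le> (norm z)\<^sup>2"
        unfolding xy(3) using p_sum_norm_ge(1)[OF p1 p(2) FE] by (intro power_mono) auto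
      finally have 1: "q x x \<le> (norm z)\<^sup>2" .
      have "ip y y = (norm y)\<^sup>2" by (rule ip(2)[OF FE(2)])
      also have "\<dots> \<le> (norm z)\<^sup>2"
        unfolding xy(3) using p_sum_norm_ge(2)[OF p1 p(2) FE] by (intro power_mono) auto
      finally have 2: "ip y y \<le> (norm z)\<^sup>2" .
      have "h z z \<le> \<theta> * (norm z)\<^sup>2 + \<mu> * (norm z)\<^sup>2"
        unfolding xy(3) h(2)[OF xy(1,2)] using 1 2 mu xy(3) by (intro add_mono mult_left_mono) auto
      also have "\<dots> = (norm z)\<^sup>2" using mu(4) by (simp flip: distrib_right)
      finally show ?thesis .
    qed
    then have "gauss (B \<union> B') q \<le> gauss (B \<union> B') h"
      by (intro extremalD(2)[OF q]) (simp add: norm_dominated_def h(1))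
    then have le: "gauss B q * gauss B' q \<le> gauss B (\<lambda>x y. \<theta> * q x y) * gauss B' (\<lambda>x y. \<mu> * ip x y)"
      using gauss_extremal_split[OF B(1) B'(1) U iso q] h(3) by simp
    define k n where "k = card B" and "n = card B'"
    note sB = inner_product_onD(1)[OF qB] and sB' = inner_product_onD(1)[OF ipB']
    have gpos: "gauss B q > 0" "gauss B' ip > 0" by (rule gauss_pos[OF B(1) sB], rule gauss_pos[OF B'(1) sB'])
    have gfin: "gauss B q < \<infinity>" "gauss B' ip < \<infinity>"
      by (rule gauss_finite[OF B(1,2) qB], rule gauss_finite[OF B'(1,2) ipB'])
    obtain \<alpha> where al: "gauss B q = ennreal \<alpha>" "\<alpha> > 0"
      using gpos(1) gfin(1) by (cases "gauss B q") (auto simp: less_le)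
    obtain \<beta> where be: "gauss B' ip = ennreal \<beta>" "\<beta> > 0"
      using gpos(2) gfin(2) by (cases "gauss B' ip") (auto simp: less_le)
    have "ennreal (1 / sqrt \<gamma> ^ n) * gauss B' ip = gauss B' (\<lambda>x y. \<gamma> * ip x y)"
      unfolding n_def by (rule gauss_form_scale[OF B'(1) sB' gam(1), symmetric])
    also have "\<dots> \<le> gauss B' q" by (rule gauss_antimono[OF qE])
    finally have "gauss B q * (ennreal (1 / sqrt \<gamma> ^ n) * gauss B' ip) \<le> gauss B q * gauss B' q"
      by (rule mult_left_mono) simp
    also note le
    also have "gauss B (\<lambda>x y. \<theta> * q x y) * gauss B' (\<lambda>x y. \<mu> * ip x y)
      = (ennreal (1 / sqrt \<theta> ^ k) * gauss B q) * (ennreal (1 / sqrt \<mu> ^ n) * gauss B' ip)"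
      unfolding k_def n_def gauss_form_scale[OF B(1) sB mu(3)] gauss_form_scale[OF B'(1) sB' mu(2)] ..
    finally have le_ennreal: "gauss B q * (ennreal (1 / sqrt \<gamma> ^ n) * gauss B' ip)
      \<le> ennreal (1 / sqrt \<theta> ^ k) * gauss B q * (ennreal (1 / sqrt \<mu> ^ n) * gauss B' ip)" .
    have "\<alpha> * (c * \<beta>) \<le> c' * \<alpha> * (c'' * \<beta>)"
      if "gauss B q * (ennreal c * gauss B' ip) \<le> ennreal c' * gauss B q * (ennreal c'' * gauss B' ip)"
        "c \<ge> 0" "c' \<ge> 0" "c'' \<ge> 0" for c c' c''
      using that al be by (simp flip: ennreal_mult)
    from this[OF le_ennreal] have "\<alpha> * (1 / sqrt \<gamma> ^ n * \<beta>) \<le> 1 / sqrt \<theta> ^ k * \<alpha> * (1 / sqrt \<mu> ^ n * \<beta>)"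
      using gam(1) mu(2,3) by simp
    then have "(sqrt \<mu> / sqrt \<gamma>) ^ n \<le> 1 / sqrt \<theta> ^ k"
      using al be mu gam by (simp add: field_simps power_divide)
    moreover have "(sqrt \<mu> / sqrt \<gamma>) ^ N \<le> (sqrt \<mu> / sqrt \<gamma>) ^ n"
      using ratio B'(4) by (intro power_increasing) (auto simp: n_def)
    ultimately show False using N by (simp add: k_def)
  qed
  then show ?thesis using that by blast
qed

text \<open>The point of the ellipsoid in the direction of \<open>v\<close> is \<open>v\<close> divided by \<open>sqrt (q v v)\<close>. It bounds the
  real supremum from below because the functional is bounded on the ellipsoid.\<close>

lemma eta_ge:
  fixes B :: "'a::real_normed_vector set"
  assumes B: "finite B" "independent B" and q: "extremal B q"
    and v: "v \<in> span B" "v \<noteq> 0"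
  shows "\<bar>blinfun_apply g v\<bar> / sqrt (q v v) \<le> eta g (span B)"
proof -
  note d = norm_dominatedD[OF extremalD(1)[OF q]]
  have qv: "q v v > 0" by (rule inner_product_onD(2)[OF d(1) v])
  have e: "min_ellipsoid (span B) = {x \<in> span B. q x x \<le> 1}" by (rule min_ellipsoid_eq[OF B q])
  have "linear_functional_on (span B) (blinfun_apply g)"
    by (simp add: linear_functional_on_def blinfun.add_right blinfun.scaleR_right)
  then obtain C where C: "C > 0" "\<And>x. x \<in> span B \<Longrightarrow> (blinfun_apply g x)\<^sup>2 \<le> C * q x x"
    using linear_functional_on_bounded_by_form[OF B(1) d(1)] by blast
  have "\<bar>blinfun_apply g x\<bar> \<le> sqrt C" if "x \<in> min_ellipsoid (span B)" for x
  proof -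
    have x: "x \<in> span B" "q x x \<le> 1" using that e by auto
    have "(blinfun_apply g x)\<^sup>2 \<le> C * q x x" by (rule C(2)[OF x(1)])
    also have "\<dots> \<le> C * 1" using x C(1) by (intro mult_left_mono) auto
    finally show ?thesis by (intro real_le_rsqrt) simp
  qed
  then have bdd: "bdd_above ((\<lambda>y. \<bar>blinfun_apply g y\<bar>) ` min_ellipsoid (span B))"
    by (intro bdd_aboveI2)
  let ?w = "(1 / sqrt (q v v)) *\<^sub>R v"
  have "q ?w ?w = 1"
    using form_square_scale[OF subspace_span d(2) v(1), of "1 / sqrt (q v v)"] qv by (simp add: power_divide)
  then have "?w \<in> min_ellipsoid (span B)" using v(1) by (simp add: e span_scale)
  from cSUP_upper[OF this bdd] show ?thesis
    using qv by (simp add: eta_def blinfun.scaleR_right abs_mult)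
qed

text \<open>Given \<open>H\<close>, a subspace \<open>G\<close> is built from the components of \<open>H\<close>, a vector \<open>v\<close> of \<open>F\<close> on which the
  functional does not vanish, and arbitrarily many dimensions of \<open>E\<close>; only the latter grow, so that
  the extremal form becomes small at \<open>v\<close>.\<close>

lemma not_DES_p_sum:
  fixes F E :: "'a::real_normed_vector set"
  assumes p: "2 < p" "is_p_sum p F E" and iso: "isometric_to_ell2 E"
    and f: "f \<in> dual_of F" and nz: "pair_functional F E f (\<lambda>_. 0) \<noteq> 0"
  shows "\<not> DES (pair_functional F E f (\<lambda>_. 0))"
proof
  define g where "g = pair_functional F E f (\<lambda>_. 0)"
  assume "DES (pair_functional F E f (\<lambda>_. 0))"
  then obtain H where H: "subspace H" "finite_dim H"
    and sup: "(SUP G\<in>{G. subspace G \<and> finite_dim G \<and> H \<subseteq> G}. ereal (eta g G)) < \<infinity>"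
    unfolding DES_def g_def INF_less_iff by blast
  then have "(SUP G\<in>{G. subspace G \<and> finite_dim G \<and> H \<subseteq> G}. ereal (eta g G)) \<noteq> \<infinity>" by simp
  then obtain n where n: "(SUP G\<in>{G. subspace G \<and> finite_dim G \<and> H \<subseteq> G}. ereal (eta g G)) < ereal (real n)"
    unfolding less_PInf_Ex_of_nat by blast
  have bound: "eta g G < real n" if "subspace G" "finite_dim G" "H \<subseteq> G" for G
  proof -
    have "ereal (eta g G) \<le> (SUP G\<in>{G. subspace G \<and> finite_dim G \<and> H \<subseteq> G}. ereal (eta g G))"
      using that by (intro SUP_upper) simp
    then have "ereal (eta g G) < ereal (real n)" using n by (rule order.strict_trans1)
    then show ?thesis by simp
  qed
  note ps = p_sumD[OF p(2)]
  have p1: "1 \<le> p" using p(1) by (rule exponent_ge_1)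
  have g_apply: "blinfun_apply g (x + y) = f x" if "x \<in> F" "y \<in> E" for x y
    unfolding g_def by (rule pair_functional_zero_apply[OF p1 p(2) f that])
  obtain z where z: "blinfun_apply g z \<noteq> 0" using nz g_def by (metis blinfun_eqI zero_blinfun.rep_eq)
  obtain v y0 where v: "v \<in> F" "y0 \<in> E" "z = v + y0" using ps(4) by blast
  have gv: "blinfun_apply g v \<noteq> 0"
    using z g_apply[OF v(1,2)] g_apply[OF v(1) subspace_0[OF ps(2)]] v(3) by simp
  then have v0: "v \<noteq> 0" by (auto simp: blinfun.zero_right)
  obtain A where A: "finite A" "span A = H" using H(2) by (auto simp: finite_dim_def)
  obtain X Y where XY: "\<And>z. X z \<in> F" "\<And>z. Y z \<in> E" "\<And>z. z = X z + Y z" using ps(4) by metis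
  obtain B where B: "finite B" "independent B" "span B = span (insert v (X ` A))"
    using finite_dim_subspace_basis[OF subspace_span _ order_refl, of "insert v (X ` A)"] A(1) by auto
  have "span (insert v (X ` A)) \<subseteq> F" using v XY(1) ps(1) by (intro span_minimal) auto
  then have BF: "B \<subseteq> F" using span_superset[of B] B(3) by simp
  have vB: "v \<in> span B" using B(3) by (simp add: span_base)
  obtain ip where ip: "sym_bilinear_on E ip" "\<And>y. y \<in> E \<Longrightarrow> ip y y = (norm y)\<^sup>2"
    using isometric_to_ell2_inner_product[OF ps(2) iso] by blast
  \<comment> \<open>If \<open>q v v < \<epsilon>\<close>, then the normalised \<open>v\<close> has a value above \<open>n\<close>.\<close>
  define \<epsilon> where "\<epsilon> = (blinfun_apply g v / (real n + 1))\<^sup>2"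
  have eps: "\<epsilon> > 0" using gv by (simp add: \<epsilon>_def)
  obtain N where N: "\<And>B' q. finite B' \<Longrightarrow> independent B' \<Longrightarrow> B' \<subseteq> E \<Longrightarrow> N \<le> card B' \<Longrightarrow>
      extremal (B \<union> B') q \<Longrightarrow> q v v < \<epsilon>"
    using extremal_small_at[OF p ip B(1,2) BF vB v0 eps] by blast
  obtain W where W: "W \<subseteq> E" "finite W" "independent W" "card W = N"
    using isometric_to_ell2_independent[OF ps(2) iso] by blast
  obtain B' where B': "finite B'" "independent B'" "span B' = span (W \<union> Y ` A)"
    using finite_dim_subspace_basis[OF subspace_span _ order_refl, of "W \<union> Y ` A"] A(1) W(2) by auto
  have "span (W \<union> Y ` A) \<subseteq> E" using W(1) XY(2) ps(2) by (intro span_minimal) auto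
  then have BE: "B' \<subseteq> E" using span_superset[of B'] B'(3) by simp
  have "W \<subseteq> span B'" using B'(3) span_superset[of "W \<union> Y ` A"] by auto
  then have card: "N \<le> card B'" using independent_span_bound[OF B'(1) W(3)] W(4) by simp
  have U: "independent (B \<union> B')"
    using independent_Un_direct(2)[OF ps(1-3) B(1,2) BF B'(1,2) BE] .
  have fU: "finite (B \<union> B')" using B B' by simp
  let ?G = "span (B \<union> B')"
  have "A \<subseteq> ?G"
  proof
    fix a assume a: "a \<in> A"
    have "X a \<in> span B" "Y a \<in> span B'" using a B(3) B'(3) by (auto intro: span_base)
    then show "a \<in> ?G" using XY(3)[of a] unfolding span_Un by blast
  qed
  then have HG: "H \<subseteq> ?G" using A(2) by (metis span_minimal subspace_span)
  obtain q where q: "extremal (B \<union> B') q" using extremal_exists[OF fU U] by blast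
  have vG: "v \<in> ?G" using vB span_mono[of B "B \<union> B'"] by auto
  have qv: "0 < q v v" by (rule inner_product_onD(2)[OF norm_dominatedD(1)[OF extremalD(1)[OF q]] vG v0])
  have "q v v < \<epsilon>" by (rule N[OF B'(1,2) BE card q])
  then have "sqrt (q v v) < sqrt \<epsilon>" by simp
  also have "sqrt \<epsilon> = \<bar>blinfun_apply g v\<bar> / (real n + 1)" by (simp add: \<epsilon>_def)
  finally have "sqrt (q v v) < \<bar>blinfun_apply g v\<bar> / (real n + 1)" .
  then have "real n + 1 < \<bar>blinfun_apply g v\<bar> / sqrt (q v v)"
    using qv by (simp add: field_simps)
  also have "\<dots> \<le> eta g ?G" by (rule eta_ge[OF fU U q vG v0])
  also have "\<dots> < real n" using fU HG by (intro bound) (auto simp: finite_dim_def)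
  finally show False by simp
qed

theorem theorem2p6:
  fixes F E :: "'a::banach set" and p :: ereal
  assumes "1 \<le> p" and "is_p_sum p F E"
  shows "(p \<le> 2 \<and> finite_dim F \<longrightarrow>
            (\<forall>f\<in>dual_of F. norm (pair_functional F E f (\<lambda>_. 0)) = 1 \<longrightarrow>
               DES (pair_functional F E f (\<lambda>_. 0)))) \<and>
         (2 < p \<and> isometric_to_ell2 E \<longrightarrow>
            (\<forall>f\<in>dual_of F. norm (pair_functional F E f (\<lambda>_. 0)) = 1 \<longrightarrow>
               \<not> DES (pair_functional F E f (\<lambda>_. 0))))"
proof (intro conjI impI ballI)
  fix f assume p: "p \<le> 2 \<and> finite_dim F" and f: "f \<in> dual_of F"
  let ?g = "pair_functional F E f (\<lambda>_. 0)"
  have "(INF H\<in>{H. subspace H \<and> finite_dim H}.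
      SUP G\<in>{G. subspace G \<and> finite_dim G \<and> H \<subseteq> G}. ereal (eta ?g G))
    \<le> (SUP G\<in>{G. subspace G \<and> finite_dim G \<and> F \<subseteq> G}. ereal (eta ?g G))"
    using p p_sumD(1)[OF assms(2)] by (intro INF_lower) simp
  also have "\<dots> \<le> ereal (eta ?g F)"
    using eta_p_sum_eq[OF assms(1) _ assms(2) f] p by (intro SUP_least) simp
  also have "\<dots> < \<infinity>" by simp
  finally show "DES ?g" unfolding DES_def .
next
  fix f assume "2 < p \<and> isometric_to_ell2 E" "f \<in> dual_of F" "norm (pair_functional F E f (\<lambda>_. 0)) = 1"
  then show "\<not> DES (pair_functional F E f (\<lambda>_. 0))"
    using assms(2) by (intro not_DES_p_sum) auto
qed

end
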